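(* Let $A_0,\dots,A_n\in\mathcal S^p$ be such that the system $\mathcal A(\mathbf x)\in\mathcal{COP}^p$ is consistent, and let $Y^*$ be a maximum slack in this system. Consider the following conditions. I) $\mathbf b(k,j)\in\mathrm{cone}\{\mathbf a(\mathbf t):\mathbf t\in T_{im}\}$ for all $k\in M(j)$ and all $j\in J$. A1) The set $\mathrm{cone}\{\mathbf a(\mathbf t):\mathbf t\in T_{im}\}$ is a (linear) subspace. A2) There exists a matrix $U^*\in\mathcal{CP}^p$ of the form $U^*=\sum_{i\in I}\alpha_i\mathbf t(i)\mathbf t(i)^\top+\frac14\sum_{(l,q)\in V_0}(\boldsymbol\tau(l)+\boldsymbol\tau(q))(\boldsymbol\tau(l)+\boldsymbol\tau(q))^\top$ with $\alpha_i>0$, $\mathbf t(i)\in T_{im}$, $i\in I$, $|I|<\infty$, such that $A_m\bullet U^*=0$ for all $m=0,1,\dots,n$. A3) There is $U^*\in\mathcal N(\mathcal B^* )\cap\mathcal{CP}^p$ strictly complementary to $Y^*$. B1) For any $\mathbf z\in\mathbb R^{n+1}$, the equalities $\boldsymbol\tau(i)^\top\mathcal B(\mathbf z)\boldsymbol\tau(j)=0$ for all $(i,j)\in V_0$ imply the equalities $\mathbf e_k^\top\mathcal B(\mathbf z)\boldsymbol\tau(j)=0$ for all $k\in M(j)$ and all $j\in J$. B2) The set $\mathcal R(\mathcal B)\cap\bigl(\mathrm{tan}(Y^*,\mathcal{COP}^p)\setminus\mathrm{ldir}(Y^*,\mathcal{COP}^p)\bigr)$ is empty. Then for any $k\in\{1,2,3\}$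 and any $m\in\{1,2\}$, the conditions i) and ii) below are equivalent to each other, and are necessary for the system $\mathcal A(\mathbf x)\in\mathcal{COP}^p$ to yield the uniform LP duality: i) the condition I) holds true; ii) the conditions A$k$) and B$m$) hold true.
   Context: Fix integers $p>1$, $n\ge 1$. $\mathcal S^p$ is the space of real symmetric $p\times p$ matrices with $A\bullet B=\mathrm{trace}(AB)$; $\mathbf e_1,\dots,\mathbf e_p$ is the standard basis of $\mathbb R^p$; $\mathbb R^p_+$ is the set of vectors with non-negative components; $P=\{1,\dots,p\}$; $T=\{\mathbf t\in\mathbb R^p_+:\sum_{k\in P} t_k=1\}$; $\mathcal{COP}^p=\{D\in\mathcal S^p:\mathbf t^\top D\mathbf t\ge 0\ \forall \mathbf t\in\mathbb R^p_+\}$; $\mathcal{CP}^p=\mathrm{conv}\{\mathbf t\mathbf t^\top:\mathbf t\in\mathbb R^p_+\}$. For a set $\mathcal B$, $\mathrm{cone}\,\mathcal B$ is the set of all finite linear combinations of elements of $\mathcal B$ with non-negative coefficients (so $\mathrm{cone}\,\emptyset=\{0\}$). Given $A_0,\dots,A_n\in\mathcal S^p$, put $\mathcal A(\mathbf x)=A_0+\sum_{m=1}^n x_mA_m$ for $\mathbf x\in\mathbb R^n$, $\mathcal B(\mathbf z)=\sum_{m=0}^n z_mA_m$ for $\mathbf z=(z_0,\dots,z_n)^\top\in\mathbb R^{n+1}$, $\mathcal R(\mathcal B)=\{\mathcal B(\mathbf z):\mathbf z\in\mathbb R^{n+1}\}$, $\mathcal N(\mathcal B^* )=\{U\in\mathcal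 S^p:A_m\bullet U=0\ \forall m=0,1,\dots,n\}$, and $X=\{\mathbf x\in\mathbb R^n:\mathcal A(\mathbf x)\in\mathcal{COP}^p\}$. The system is consistent if $X\ne\emptyset$. For $\mathbf c\in\mathbb R^n$ consider the primal problem (P): $\min \mathbf c^\top\mathbf x$ s.t. $\mathbf x\in X$, and its Lagrange dual (D): $\max\,(-U\bullet A_0)$ s.t. $U\bullet A_m=c_m$, $m=1,\dots,n$, $U\in\mathcal{CP}^p$; $Val(\cdot)$ denotes the optimal value. A consistent system yields the uniform LP duality if for every $\mathbf c\in\mathbb R^n$ with $Val(\mathrm P)>-\infty$ the dual (D) has an optimal solution and $Val(\mathrm P)=Val(\mathrm D)$. $T_{im}=\{\mathbf t\in T:\mathbf t^\top\mathcal A(\mathbf x)\mathbf t=0\ \forall\mathbf x\in X\}$ is the set of normalized immobile indices; it is empty or a finite union of convex bounded polyhedra. $\{\boldsymbol\tau(j):j\in J\}$, $|J|<\infty$, is the set of vertices of $\mathrm{conv}\,T_{im}$ ($J=\emptyset$ if $T_{im}=\emptyset$). For $j\in J$: $M(j)=\{k\in P:\mathbf e_k^\top\mathcal A(\mathbf x)\boldsymbol\tau(j)=0\ \forall\mathbf x\in X\}$. Vectors in $\mathbb R^{n+1}$: $\mathbf a(\mathbf t)=(\mathbf t^\top A_m\mathbf t)_{m=0,\dots,n}$ for $\mathbf t\in T$, and $\mathbf b(k,j)=(\mathbf e_k^\top A_m\boldsymbol\tau(j))_{m=0,\dots,n}$ for $k\in P$, $j\in J$. Subsets $J(s)\subset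 J$, $s\in S$ ($S$ finite; the subsets need not be disjoint) are fixed such that $T_{im}=\bigcup_{s\in S}T_{im}(s)$ with $T_{im}(s)=\mathrm{conv}\{\boldsymbol\tau(j):j\in J(s)\}$, and such that for every $s\in S$ the set $P_*(s)=\bigcup_{j\in J(s)}\{k\in P:\tau_k(j)>0\}$ satisfies $P_*(s)\subset M(j)$ for all $j\in J(s)$; it is known that such subsets exist. Numbering $J(s)=\{i_1,\dots,i_{k(s)}\}$, put $V(s)=\{(i_k,i_q):1\le k\le q\le k(s)\}$ and $V_0=\bigcup_{s\in S}V(s)$. A matrix $Y$ is a maximum slack in the system if $Y\in\mathrm{relint}\,\mathcal D$ (relative interior), where $\mathcal D=\{\mathcal A(\mathbf x):\mathbf x\in X\}$. For $Y\in\mathcal{COP}^p$, $Y^\perp=\{U\in\mathcal S^p:Y\bullet U=0\}$, and $U\in\mathcal{CP}^p$ is strictly complementary to $Y$ if $U\in\mathrm{relint}(\mathcal{CP}^p\cap Y^\perp)$. Further, $\mathrm{dir}(Y,\mathcal{COP}^p)=\{D\in\mathcal S^p:Y+\varepsilon D\in\mathcal{COP}^p\text{ for some }\varepsilon>0\}$, $\mathrm{ldir}(Y,\mathcal{COP}^p)=\mathrm{dir}(Y,\mathcal{COP}^p)\cap(-\mathrm{dir}(Y,\mathcal{COP}^p))$, and $\mathrm{tan}(Y,\mathcal{COP}^p)=\mathrm{cl}(\mathrm{dir}(Y,\mathcal{COP}^p))\cap(-\mathrm{cl}(\mathrm{dir}(Y,\mathcal{COP}^p)))$, where $\mathrm{cl}$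 is the closure. *)

theory Defs
  imports "HOL-Analysis.Analysis"
begin

text \<open>
  The size \<open>p\<close> and the number \<open>n\<close> of variables are the cardinalities of the finite index types
  \<open>'p\<close> and \<open>'n\<close>. The index range \<open>0,\<dots>,n\<close> is the type \<open>'n option\<close>, with \<open>None\<close> playing
  the role of \<open>0\<close>; thus \<open>\<real>\<^sup>n\<^sup>+\<^sup>1\<close> is \<open>real ^ 'n option\<close>, and the data \<open>A\<^sub>0,\<dots>,A\<^sub>n\<close> form a
  function \<open>A :: 'n option \<Rightarrow> real ^ 'p ^ 'p\<close>.
\<close>

subsection \<open>Symmetric, copositive and completely positive matrices\<close>

definition sym_mats :: "(real ^ 'p ^ 'p) set" where
  "sym_mats = {D. transpose D = D}"

definition mdot :: "real ^ 'p ^ 'p \<Rightarrow> real ^ 'p ^ 'p \<Rightarrow> real" (infixl "\<bullet>\<bullet>" 70) where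
  "U \<bullet>\<bullet> V = trace (U ** V)"

definition nonneg_vecs :: "(real ^ 'p) set" where
  "nonneg_vecs = {t. \<forall>k. 0 \<le> t $ k}"

definition std_simplex :: "(real ^ 'p) set" where
  "std_simplex = {t \<in> nonneg_vecs. (\<Sum>k\<in>UNIV. t $ k) = 1}"

definition sq_outer :: "real ^ 'p \<Rightarrow> real ^ 'p ^ 'p" where
  "sq_outer t = (\<chi> i j. t $ i * t $ j)"

definition COP :: "(real ^ 'p ^ 'p) set" where
  "COP = {D \<in> sym_mats. \<forall>t \<in> nonneg_vecs. 0 \<le> t \<bullet> (D *v t)}"

definition CP :: "(real ^ 'p ^ 'p) set" where
  "CP = convex hull (sq_outer ` nonneg_vecs)"

text \<open>
  The library's \<open>cone hull\<close> only closes under scaling; the conic hull meant here also closes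
  under sums, and \<open>lin_cone {} = {0}\<close>.
\<close>

definition lin_cone :: "'v::real_vector set \<Rightarrow> 'v set" where
  "lin_cone B = {v. \<exists>F c. finite F \<and> F \<subseteq> B \<and> (\<forall>b\<in>F. 0 \<le> c b) \<and> v = (\<Sum>b\<in>F. c b *\<^sub>R b)}"

subsection \<open>Linear copositive systems and uniform duality\<close>

definition pencil :: "('n::finite option \<Rightarrow> real ^ 'p ^ 'p) \<Rightarrow> real ^ 'n \<Rightarrow> real ^ 'p ^ 'p" where
  "pencil A x = A None + (\<Sum>m\<in>UNIV. (x $ m) *\<^sub>R A (Some m))"

definition lin_map :: "('n::finite option \<Rightarrow> real ^ 'p ^ 'p) \<Rightarrow> real ^ 'n option \<Rightarrow> real ^ 'p ^ 'p" where
  "lin_map A z = (\<Sum>m\<in>UNIV. (z $ m) *\<^sub>R A m)"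

definition adj_null :: "('n::finite option \<Rightarrow> real ^ 'p ^ 'p) \<Rightarrow> (real ^ 'p ^ 'p) set" where
  "adj_null A = {U \<in> sym_mats. \<forall>m. A m \<bullet>\<bullet> U = 0}"

definition feasible :: "('n::finite option \<Rightarrow> real ^ 'p ^ 'p) \<Rightarrow> (real ^ 'n) set" where
  "feasible A = {x. pencil A x \<in> COP}"

definition consistent :: "('n::finite option \<Rightarrow> real ^ 'p ^ 'p) \<Rightarrow> bool" where
  "consistent A \<longleftrightarrow> feasible A \<noteq> {}"

definition val_P :: "('n::finite option \<Rightarrow> real ^ 'p ^ 'p) \<Rightarrow> real ^ 'n \<Rightarrow> ereal" where
  "val_P A c = (INF x\<in>feasible A. ereal (c \<bullet> x))"

definition dual_feasible ::
    "('n::finite option \<Rightarrow> real ^ 'p ^ 'p) \<Rightarrow> real ^ 'n \<Rightarrow> (real ^ 'p ^ 'p) set" where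
  "dual_feasible A c = {U \<in> CP. \<forall>m. U \<bullet>\<bullet> A (Some m) = c $ m}"

definition val_D :: "('n::finite option \<Rightarrow> real ^ 'p ^ 'p) \<Rightarrow> real ^ 'n \<Rightarrow> ereal" where
  "val_D A c = (SUP U\<in>dual_feasible A c. ereal (- (U \<bullet>\<bullet> A None)))"

definition dual_optimal ::
    "('n::finite option \<Rightarrow> real ^ 'p ^ 'p) \<Rightarrow> real ^ 'n \<Rightarrow> real ^ 'p ^ 'p \<Rightarrow> bool" where
  "dual_optimal A c U \<longleftrightarrow>
     U \<in> dual_feasible A c \<and> (\<forall>W\<in>dual_feasible A c. - (W \<bullet>\<bullet> A None) \<le> - (U \<bullet>\<bullet> A None))"

definition uniform_LP_duality :: "('n::finite option \<Rightarrow> real ^ 'p ^ 'p) \<Rightarrow> bool" where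
  "uniform_LP_duality A \<longleftrightarrow>
     (\<forall>c. val_P A c > -\<infinity> \<longrightarrow> (\<exists>U. dual_optimal A c U) \<and> val_P A c = val_D A c)"

subsection \<open>Immobile indices\<close>

definition immobile :: "('n::finite option \<Rightarrow> real ^ 'p ^ 'p) \<Rightarrow> (real ^ 'p) set" where
  "immobile A = {t \<in> std_simplex. \<forall>x \<in> feasible A. t \<bullet> (pencil A x *v t) = 0}"

definition vertex_enumeration ::
    "('n::finite option \<Rightarrow> real ^ 'p ^ 'p) \<Rightarrow> 'j set \<Rightarrow> ('j \<Rightarrow> real ^ 'p) \<Rightarrow> bool" where
  "vertex_enumeration A J \<tau> \<longleftrightarrow>
     finite J \<and> bij_betw \<tau> J {v. v extreme_point_of (convex hull immobile A)}"

definition M_set ::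
    "('n::finite option \<Rightarrow> real ^ 'p ^ 'p) \<Rightarrow> ('j \<Rightarrow> real ^ 'p) \<Rightarrow> 'j \<Rightarrow> 'p set" where
  "M_set A \<tau> j = {k. \<forall>x \<in> feasible A. axis k 1 \<bullet> (pencil A x *v \<tau> j) = 0}"

definition a_vec :: "('n::finite option \<Rightarrow> real ^ 'p ^ 'p) \<Rightarrow> real ^ 'p \<Rightarrow> real ^ 'n option" where
  "a_vec A t = (\<chi> m. t \<bullet> (A m *v t))"

definition b_vec ::
    "('n::finite option \<Rightarrow> real ^ 'p ^ 'p) \<Rightarrow> ('j \<Rightarrow> real ^ 'p) \<Rightarrow> 'p \<Rightarrow> 'j \<Rightarrow> real ^ 'n option" where
  "b_vec A \<tau> k j = (\<chi> m. axis k 1 \<bullet> (A m *v \<tau> j))"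

text \<open>
  For \<open>s \<in> S\<close> the list \<open>Js s\<close> is the numbering \<open>i\<^sub>1,\<dots>,i\<^bsub>k(s)\<^esub>\<close> of \<open>J(s) \<subseteq> J\<close>; the order matters
  only for which of the pairs \<open>(i,j)\<close>, \<open>(j,i)\<close> belongs to \<open>V(s)\<close>.
\<close>

definition P_star :: "('j \<Rightarrow> real ^ 'p) \<Rightarrow> 'j list \<Rightarrow> 'p set" where
  "P_star \<tau> js = (\<Union>j\<in>set js. {k. 0 < \<tau> j $ k})"

definition immobile_decomposition ::
    "('n::finite option \<Rightarrow> real ^ 'p ^ 'p) \<Rightarrow> 'j set \<Rightarrow> ('j \<Rightarrow> real ^ 'p) \<Rightarrow> 's set \<Rightarrow> ('s \<Rightarrow> 'j list) \<Rightarrow> bool"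
  where
  "immobile_decomposition A J \<tau> S Js \<longleftrightarrow>
     finite S \<and>
     (\<forall>s\<in>S. distinct (Js s) \<and> set (Js s) \<subseteq> J) \<and>
     immobile A = (\<Union>s\<in>S. convex hull (\<tau> ` set (Js s))) \<and>
     (\<forall>s\<in>S. \<forall>j\<in>set (Js s). P_star \<tau> (Js s) \<subseteq> M_set A \<tau> j)"

definition V_pairs :: "'j list \<Rightarrow> ('j \<times> 'j) set" where
  "V_pairs js = {(js ! k, js ! q) | k q. k \<le> q \<and> q < length js}"

definition V0 :: "'s set \<Rightarrow> ('s \<Rightarrow> 'j list) \<Rightarrow> ('j \<times> 'j) set" where
  "V0 S Js = (\<Union>s\<in>S. V_pairs (Js s))"

subsection \<open>Maximum slacks, complementarity and directions\<close>

definition max_slack :: "('n::finite option \<Rightarrow> real ^ 'p ^ 'p) \<Rightarrow> real ^ 'p ^ 'p \<Rightarrow> bool" where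
  "max_slack A Y \<longleftrightarrow> Y \<in> rel_interior (pencil A ` feasible A)"

definition mat_perp :: "real ^ 'p ^ 'p \<Rightarrow> (real ^ 'p ^ 'p) set" where
  "mat_perp Y = {U \<in> sym_mats. Y \<bullet>\<bullet> U = 0}"

definition strictly_complementary :: "real ^ 'p ^ 'p \<Rightarrow> real ^ 'p ^ 'p \<Rightarrow> bool" where
  "strictly_complementary U Y \<longleftrightarrow> U \<in> rel_interior (CP \<inter> mat_perp Y)"

definition dir_COP :: "real ^ 'p ^ 'p \<Rightarrow> (real ^ 'p ^ 'p) set" where
  "dir_COP Y = {D \<in> sym_mats. \<exists>\<epsilon>>0. Y + \<epsilon> *\<^sub>R D \<in> COP}"

definition ldir_COP :: "real ^ 'p ^ 'p \<Rightarrow> (real ^ 'p ^ 'p) set" where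
  "ldir_COP Y = dir_COP Y \<inter> uminus ` dir_COP Y"

definition tan_COP :: "real ^ 'p ^ 'p \<Rightarrow> (real ^ 'p ^ 'p) set" where
  "tan_COP Y = closure (dir_COP Y) \<inter> uminus ` closure (dir_COP Y)"

subsection \<open>The conditions\<close>

definition cond_I ::
    "('n::finite option \<Rightarrow> real ^ 'p ^ 'p) \<Rightarrow> 'j set \<Rightarrow> ('j \<Rightarrow> real ^ 'p) \<Rightarrow> bool" where
  "cond_I A J \<tau> \<longleftrightarrow>
     (\<forall>j\<in>J. \<forall>k\<in>M_set A \<tau> j. b_vec A \<tau> k j \<in> lin_cone (a_vec A ` immobile A))"

definition cond_A1 :: "('n::finite option \<Rightarrow> real ^ 'p ^ 'p) \<Rightarrow> bool" where
  "cond_A1 A \<longleftrightarrow> subspace (lin_cone (a_vec A ` immobile A))"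

definition cond_A2 ::
    "('n::finite option \<Rightarrow> real ^ 'p ^ 'p) \<Rightarrow> ('j \<Rightarrow> real ^ 'p) \<Rightarrow> 's set \<Rightarrow> ('s \<Rightarrow> 'j list) \<Rightarrow> bool" where
  "cond_A2 A \<tau> S Js \<longleftrightarrow>
     (\<exists>U\<in>CP.
        (\<exists>(I :: nat set) \<alpha> t. finite I \<and> (\<forall>i\<in>I. 0 < \<alpha> i \<and> t i \<in> immobile A) \<and>
           U = (\<Sum>i\<in>I. \<alpha> i *\<^sub>R sq_outer (t i))
               + (1 / 4) *\<^sub>R (\<Sum>(l, q)\<in>V0 S Js. sq_outer (\<tau> l + \<tau> q))) \<and>
        (\<forall>m. A m \<bullet>\<bullet> U = 0))"

definition cond_A3 :: "('n::finite option \<Rightarrow> real ^ 'p ^ 'p) \<Rightarrow> real ^ 'p ^ 'p \<Rightarrow> bool" where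
  "cond_A3 A Y \<longleftrightarrow> (\<exists>U \<in> adj_null A \<inter> CP. strictly_complementary U Y)"

definition cond_B1 ::
    "('n::finite option \<Rightarrow> real ^ 'p ^ 'p) \<Rightarrow> 'j set \<Rightarrow> ('j \<Rightarrow> real ^ 'p) \<Rightarrow> 's set \<Rightarrow> ('s \<Rightarrow> 'j list) \<Rightarrow> bool"
  where
  "cond_B1 A J \<tau> S Js \<longleftrightarrow>
     (\<forall>z. (\<forall>(i, j)\<in>V0 S Js. \<tau> i \<bullet> (lin_map A z *v \<tau> j) = 0) \<longrightarrow>
          (\<forall>j\<in>J. \<forall>k\<in>M_set A \<tau> j. axis k 1 \<bullet> (lin_map A z *v \<tau> j) = 0))"

definition cond_B2 :: "('n::finite option \<Rightarrow> real ^ 'p ^ 'p) \<Rightarrow> real ^ 'p ^ 'p \<Rightarrow> bool" where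
  "cond_B2 A Y \<longleftrightarrow> range (lin_map A) \<inter> (tan_COP Y - ldir_COP Y) = {}"

end

theory Submission
  imports Defs
begin

text \<open>
  A maximum slack \<open>Y\<close> lies in the relative interior of the set of slacks, so the immobile indices are
  the zeros of the form of \<open>Y\<close> on the simplex, and \<open>M_set A \<tau> j\<close> is the set of zero entries of \<open>Y *v \<tau> j\<close>
  (\<open>immobile_eq_zeros\<close>, \<open>M_set_iff\<close>). Everything is then a statement about one copositive matrix \<open>Y\<close>
  and the linear space of the matrices \<open>lin_map A z\<close>.

  The cone generated by the vectors \<open>a_vec A t\<close> is the linear image of the face of \<open>CP\<close> exposed by \<open>Y\<close>
  (\<open>CP_Int_mat_perp\<close>). It is a subspace if and only if every form \<open>lin_map A z\<close> that is nonnegative at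
  the zeros of \<open>Y\<close> vanishes there (\<open>cond_A1_iff\<close>). Conditions A2 and A3 both exhibit a point of the face
  in the null space of the adjoint that is interior enough to force this, and such points exist when
  the cone is a subspace (\<open>cond_A2_iff\<close>, \<open>cond_A3_iff\<close>). Hence A1, A2 and A3 are equivalent.

  The tangent space at \<open>Y\<close> consists of the \<open>D\<close> whose form vanishes at the zeros, and the lineality space
  \<open>ldir_COP Y\<close> of those for which \<open>D *v \<tau> j\<close> vanishes wherever \<open>Y *v \<tau> j\<close> does (\<open>tan_COP_eq\<close>,
  \<open>ldir_COP_eq\<close>). Read in this way, B1 and B2 coincide. The substantial part is that nonnegativity of the
  gradients \<open>D *v \<tau> j\<close> at the zero entries of \<open>Y *v \<tau> j\<close> already makes \<open>D\<close> a feasible direction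
  (\<open>dir_COP_if_gradient_nonneg\<close>).

  Condition I implies B1 at once. It implies A1 because a form \<open>lin_map A z\<close> nonnegative at the zeros then
  has nonnegative gradients, hence is a feasible direction, hence leads to another slack of the system,
  whose form vanishes at the immobile indices. Conversely A1 and B1 give I by double orthogonality
  (\<open>cond_I_iff\<close>). Finally, the uniform duality implies I: applied to the objective that \<open>b_vec A \<tau> k j\<close>
  defines, which is constant on the feasible set, it yields a dual solution in the face exposed by \<open>Y\<close>
  whose image is \<open>b_vec A \<tau> k j\<close> (\<open>cond_I_if_uniform_LP_duality\<close>).
\<close>

section \<open>Bilinear forms of symmetric matrices\<close>

lemmas form_simps =
  matrix_vector_right_distrib matrix_vector_mult_add_rdistrib matrix_vector_mult_scaleR
  scaleR_matrix_vector_assoc[symmetric] inner_add_left inner_add_right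

lemma form_commute:
  assumes "D \<in> sym_mats"
  shows "u \<bullet> (D *v v) = v \<bullet> (D *v u)"
  using assms dot_lmul_matrix[of u D v] transpose_matrix_vector[of D u]
  by (simp add: sym_mats_def inner_commute)

lemma form_eq_sum: "u \<bullet> (D *v v) = (\<Sum>k\<in>UNIV. u $ k * (D *v v) $ k)"
  for D :: "real ^ 'p::finite ^ 'p"
  by (simp add: inner_vec_def)

lemma inner_axis_form: "axis k 1 \<bullet> (D *v v) = (D *v v) $ k"
  for D :: "real ^ 'p::finite ^ 'p"
  by (simp add: inner_axis')

lemma quadratic_form_scaleR: "(c *\<^sub>R t) \<bullet> (D *v (c *\<^sub>R t)) = c\<^sup>2 * (t \<bullet> (D *v t))"
  for D :: "real ^ 'p::finite ^ 'p"
  by (simp only: matrix_vector_mult_scaleR inner_scaleR_left inner_scaleR_right power2_eq_square mult.assoc)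

text \<open>
  Polarization: the mixed form is determined by the values at \<open>u\<close>, \<open>v\<close> and \<open>u + v\<close>.
\<close>

lemma quadratic_form_add:
  assumes "D \<in> sym_mats"
  shows "(u + v) \<bullet> (D *v (u + v)) = u \<bullet> (D *v u) + 2 * (u \<bullet> (D *v v)) + v \<bullet> (D *v v)"
  using form_commute[OF assms, of u v] by (simp add: form_simps)

lemma subspace_sym_mats: "subspace sym_mats"
  by (auto simp: subspace_def sym_mats_def transpose_def vec_eq_iff)

lemma sq_outer_in_sym_mats: "sq_outer t \<in> sym_mats"
  by (simp add: sym_mats_def sq_outer_def transpose_def vec_eq_iff mult.commute)

lemma mdot_sq_outer: "D \<bullet>\<bullet> sq_outer t = t \<bullet> (D *v t)"
  unfolding mdot_def trace_def matrix_matrix_mult_def sq_outer_def inner_vec_def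
    matrix_vector_mult_def
  by (auto simp: sum_distrib_left mult.commute mult.left_commute intro!: sum.cong)

lemma mdot_commute: "U \<bullet>\<bullet> V = V \<bullet>\<bullet> U"
  unfolding mdot_def by (rule trace_mul_sym)

lemma linear_mdot: "linear (\<lambda>U. D \<bullet>\<bullet> U)"
  by (auto intro!: linearI simp: mdot_def trace_def matrix_matrix_mult_def sum.distrib
      sum_distrib_left algebra_simps)

lemma mdot_scaleR_left: "(c *\<^sub>R D) \<bullet>\<bullet> U = c * (D \<bullet>\<bullet> U)"
  using linear_scale[OF linear_mdot[of U]] by (simp add: mdot_commute[of _ U])

lemma mdot_sum_left: "(\<Sum>i\<in>I. f i) \<bullet>\<bullet> U = (\<Sum>i\<in>I. f i \<bullet>\<bullet> U)"
  using linear_sum[OF linear_mdot[of U]] by (simp add: mdot_commute[of _ U])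

lemma continuous_on_quadratic_form [continuous_intros]:
  "continuous_on S (\<lambda>t. t \<bullet> (D *v t))" for D :: "real ^ 'p::finite ^ 'p"
  by (intro continuous_intros matrix_vector_mult_linear_continuous_on)

section \<open>Conic hulls and relative interiors\<close>

lemma lin_cone_eq_convex_cone_hull: "lin_cone B = convex_cone hull B"
proof (rule subset_antisym)
  have sum_in: "(\<Sum>b\<in>F. c b *\<^sub>R b) \<in> convex_cone hull B"
    if "finite F" "F \<subseteq> B" "\<forall>b\<in>F. 0 \<le> c b" for F c
    using that
  proof (induction F rule: finite_induct)
    case empty
    show ?case by (simp add: convex_cone_hull_contains_0)
  next
    case (insert b F)
    then have "c b *\<^sub>R b \<in> convex_cone hull B"
      by (intro convex_cone_hull_mul hull_inc) auto
    with insert show ?case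
      by (simp add: convex_cone_hull_add)
  qed
  then show "lin_cone B \<subseteq> convex_cone hull B"
    unfolding lin_cone_def by blast
next
  have "convex_cone (lin_cone B)"
    unfolding convex_cone_iff
  proof (intro conjI ballI allI impI)
    show "0 \<in> lin_cone B"
      by (auto simp: lin_cone_def intro!: exI[of _ "{}"])
  next
    fix x y assume "x \<in> lin_cone B" "y \<in> lin_cone B"
    then obtain F c G d where
      F: "finite F" "F \<subseteq> B" "\<forall>b\<in>F. 0 \<le> c b" "x = (\<Sum>b\<in>F. c b *\<^sub>R b)" and
      G: "finite G" "G \<subseteq> B" "\<forall>b\<in>G. 0 \<le> d b" "y = (\<Sum>b\<in>G. d b *\<^sub>R b)"
      unfolding lin_cone_def by blast
    define e where "e b = (if b \<in> F then c b else 0) + (if b \<in> G then d b else 0)" for b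
    have "x = (\<Sum>b\<in>F \<union> G. (if b \<in> F then c b else 0) *\<^sub>R b)"
      unfolding F(4) using F(1) G(1) by (intro sum.mono_neutral_cong_left) auto
    moreover have "y = (\<Sum>b\<in>F \<union> G. (if b \<in> G then d b else 0) *\<^sub>R b)"
      unfolding G(4) using F(1) G(1) by (intro sum.mono_neutral_cong_left) auto
    ultimately have "x + y = (\<Sum>b\<in>F \<union> G. e b *\<^sub>R b)"
      by (simp add: e_def scaleR_left_distrib sum.distrib)
    moreover have "\<forall>b\<in>F \<union> G. 0 \<le> e b"
      using F(3) G(3) by (auto simp: e_def)
    ultimately show "x + y \<in> lin_cone B"
      using F(1,2) G(1,2) unfolding lin_cone_def
      by (intro CollectI exI[of _ "F \<union> G"] exI[of _ e]) simp
  next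
    fix x and r :: real assume "x \<in> lin_cone B" "0 \<le> r"
    then obtain F c where
      F: "finite F" "F \<subseteq> B" "\<forall>b\<in>F. 0 \<le> c b" "x = (\<Sum>b\<in>F. c b *\<^sub>R b)"
      unfolding lin_cone_def by blast
    then have "r *\<^sub>R x = (\<Sum>b\<in>F. (r * c b) *\<^sub>R b)" "\<forall>b\<in>F. 0 \<le> r * c b"
      using \<open>0 \<le> r\<close> by (simp_all add: scaleR_sum_right)
    with F(1,2) show "r *\<^sub>R x \<in> lin_cone B"
      unfolding lin_cone_def by (intro CollectI exI[of _ F] exI[of _ "\<lambda>b. r * c b"]) simp
  qed
  moreover have "B \<subseteq> lin_cone B"
  proof
    fix b assume "b \<in> B"
    then show "b \<in> lin_cone B"
      unfolding lin_cone_def by (intro CollectI exI[of _ "{b}"] exI[of _ "\<lambda>_. 1"]) auto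
  qed
  ultimately show "convex_cone hull B \<subseteq> lin_cone B"
    by (rule hull_minimal[rotated])
qed

lemma convex_cone_hull_linear_image:
  assumes "linear f"
  shows "convex_cone hull (f ` B) = f ` (convex_cone hull B)"
proof (rule subset_antisym)
  show "convex_cone hull (f ` B) \<subseteq> f ` (convex_cone hull B)"
    using assms by (intro hull_minimal image_mono hull_subset)
      (simp add: convex_cone_linear_image convex_cone_convex_cone_hull)
next
  let ?K = "f -` (convex_cone hull (f ` B))"
  have "convex_cone ?K"
    using assms by (auto simp: convex_cone_iff linear_add linear_scale linear_0
        intro: convex_cone_hull_add convex_cone_hull_mul convex_cone_hull_contains_0)
  moreover have "B \<subseteq> ?K"
    by (auto intro: hull_inc)
  ultimately have "convex_cone hull B \<subseteq> ?K"
    by (rule hull_minimal[rotated])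
  then show "f ` (convex_cone hull B) \<subseteq> convex_cone hull (f ` B)"
    by blast
qed

lemma linear_nonneg_on_convex_cone_hull:
  fixes f :: "'a::real_vector \<Rightarrow> real"
  assumes "linear f" "\<forall>x\<in>B. 0 \<le> f x" "x \<in> convex_cone hull B"
  shows "0 \<le> f x"
proof -
  have "convex_cone {x. 0 \<le> f x}"
    using assms(1) by (simp add: convex_cone_iff linear_add linear_scale linear_0)
  with assms(2) have "convex_cone hull B \<subseteq> {x. 0 \<le> f x}"
    by (intro hull_minimal) auto
  with assms(3) show ?thesis by blast
qed

lemma linear_eq_0_on_convex_cone_hull:
  fixes f :: "'a::real_vector \<Rightarrow> real"
  assumes "linear f" "\<forall>x\<in>B. f x = 0" "x \<in> convex_cone hull B"
  shows "f x = 0"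
  using linear_nonneg_on_convex_cone_hull[of f B x] assms
    linear_nonneg_on_convex_cone_hull[of "\<lambda>x. - f x" B x]
  by (simp add: linear_compose_neg antisym)

text \<open>
  From a relative interior point \<open>y\<close> the segment coming from \<open>x\<close> can be prolonged inside \<open>S\<close>; if \<open>f\<close> were
  larger at \<open>x\<close> than at \<open>y\<close>, it would drop below its minimum on the prolongation. This is how both the
  maximum slack and a strictly complementary matrix are used.
\<close>

lemma linear_constant_if_min_in_rel_interior:
  fixes f :: "'a::euclidean_space \<Rightarrow> real"
  assumes "convex S" "linear f" "y \<in> rel_interior S" "\<forall>x\<in>S. f y \<le> f x" "x \<in> S"
  shows "f x = f y"
proof -
  have ne: "S \<noteq> {}"
    using assms(5) by auto
  have "\<forall>x\<in>S. \<exists>e>1. (1 - e) *\<^sub>R x + e *\<^sub>R y \<in> S"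
    using assms(3) by (simp only: convex_rel_interior_iff[OF assms(1) ne])
  with assms(5) obtain e where e: "e > 1" "(1 - e) *\<^sub>R x + e *\<^sub>R y \<in> S"
    by blast
  then have "f y \<le> (1 - e) * f x + e * f y"
    using assms(2,4) by (fastforce simp: linear_add linear_scale)
  then have "(e - 1) * (f x - f y) \<le> 0"
    by (simp add: algebra_simps)
  then have "f x \<le> f y"
    using e(1) by (simp add: mult_le_0_iff)
  with assms(4,5) show ?thesis by force
qed

text \<open>
  If \<open>0\<close> were not in the relative interior of \<open>C\<close>, a supporting hyperplane at \<open>0\<close> would be
  nonnegative on \<open>C\<close> without vanishing there; and around a relative interior point \<open>0\<close> the cone contains
  the opposite of each of its elements. Arguing through the relative interior, rather than by separating
  a point from \<open>C\<close>, matters because the cone generated by the vectors \<open>a_vec A t\<close> may fail to be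
  closed.
\<close>

lemma subspace_convex_cone_iff_dual:
  fixes C :: "'a::euclidean_space set"
  assumes "convex_cone C"
  shows "subspace C \<longleftrightarrow> (\<forall>z. (\<forall>y\<in>C. 0 \<le> z \<bullet> y) \<longrightarrow> (\<forall>y\<in>C. z \<bullet> y = 0))"
proof
  assume sub: "subspace C"
  show "\<forall>z. (\<forall>y\<in>C. 0 \<le> z \<bullet> y) \<longrightarrow> (\<forall>y\<in>C. z \<bullet> y = 0)"
  proof (intro allI impI ballI)
    fix z y assume nonneg: "\<forall>y\<in>C. 0 \<le> z \<bullet> y" and y: "y \<in> C"
    then have "0 \<le> z \<bullet> y" "0 \<le> z \<bullet> (- y)"
      using subspace_neg[OF sub y] by blast+
    then show "z \<bullet> y = 0" by simp
  qed
next
  assume dual: "\<forall>z. (\<forall>y\<in>C. 0 \<le> z \<bullet> y) \<longrightarrow> (\<forall>y\<in>C. z \<bullet> y = 0)"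
  have conv: "convex C" and ne: "C \<noteq> {}" and zero: "0 \<in> C"
    using assms by (auto simp: convex_cone_def convex_cone_contains_0)
  have "0 \<in> rel_interior C"
  proof (rule ccontr)
    assume "0 \<notin> rel_interior C"
    then obtain a where a: "\<And>y. y \<in> C \<Longrightarrow> a \<bullet> 0 \<le> a \<bullet> y" 
        "\<And>y. y \<in> rel_interior C \<Longrightarrow> a \<bullet> 0 < a \<bullet> y"
      using supporting_hyperplane_rel_boundary[OF conv zero] by metis
    obtain y where "y \<in> rel_interior C"
      using conv ne rel_interior_eq_empty by blast
    then have "y \<in> C" "0 < a \<bullet> y"
      using a(2) rel_interior_subset by auto
    with a(1) dual show False by force
  qed
  have neg: "- x \<in> C" if x: "x \<in> C" for x
  proof -
    have "\<forall>x\<in>C. \<exists>e>1. (1 - e) *\<^sub>R x + e *\<^sub>R 0 \<in> C"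
      using \<open>0 \<in> rel_interior C\<close> by (simp only: convex_rel_interior_iff[OF conv ne])
    with x obtain e where e: "e > 1" "(1 - e) *\<^sub>R x + e *\<^sub>R 0 \<in> C"
      by blast
    then have "(1 / (e - 1)) *\<^sub>R ((1 - e) *\<^sub>R x) \<in> C"
      using e by (intro convex_cone_scaleR[OF assms, where x = "(1 - e) *\<^sub>R x"]) auto
    moreover have "1 / (e - 1) * (1 - e) = - 1"
      using e(1) by (simp add: field_simps)
    ultimately show ?thesis by (simp only: scaleR_scaleR) simp
  qed
  show "subspace C"
    unfolding subspace_def
  proof (intro conjI ballI allI zero)
    show "x + y \<in> C" if "x \<in> C" "y \<in> C" for x y
      using assms that by (rule convex_cone_add)
    show "c *\<^sub>R x \<in> C" if "x \<in> C" for c x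
      using convex_cone_scaleR[OF assms _ that, of c] convex_cone_scaleR[OF assms _ neg[OF that], of "- c"]
      by (cases "0 \<le> c") auto
  qed
qed

lemma add_in_rel_interior_convex_cone:
  fixes u v :: "'a::euclidean_space"
  assumes "convex_cone C" "u \<in> rel_interior C" "v \<in> C"
  shows "u + v \<in> rel_interior C"
proof -
  have conv: "convex C" and ne: "C \<noteq> {}"
    using assms by (auto simp: convex_cone_def)
  have "\<exists>e>1. (1 - e) *\<^sub>R x + e *\<^sub>R (u + v) \<in> C" if "x \<in> C" for x
  proof -
    have "\<forall>x\<in>C. \<exists>e>1. (1 - e) *\<^sub>R x + e *\<^sub>R u \<in> C"
      using assms(2) by (simp only: convex_rel_interior_iff[OF conv ne])
    with that obtain e where e: "e > 1" "(1 - e) *\<^sub>R x + e *\<^sub>R u \<in> C"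
      by blast
    have "((1 - e) *\<^sub>R x + e *\<^sub>R u) + e *\<^sub>R v \<in> C"
      using e assms(3)
      by (intro convex_cone_add[OF assms(1) e(2)] convex_cone_scaleR[OF assms(1)]) auto
    with e(1) show ?thesis
      by (auto simp: algebra_simps)
  qed
  then show ?thesis
    by (simp only: convex_rel_interior_iff[OF conv ne]) blast
qed

section \<open>Zeros of a copositive matrix\<close>

definition simplex_zeros :: "real ^ 'p::finite ^ 'p \<Rightarrow> (real ^ 'p) set" where
  "simplex_zeros Y = {t \<in> std_simplex. t \<bullet> (Y *v t) = 0}"

lemma simplex_zerosD:
  assumes "t \<in> simplex_zeros Y"
  shows "t \<in> nonneg_vecs" "t \<in> std_simplex" "t \<bullet> (Y *v t) = 0" "(\<Sum>k\<in>UNIV. t $ k) = 1"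
  using assms by (auto simp: simplex_zeros_def std_simplex_def)

lemma compact_std_simplex: "compact (std_simplex :: (real ^ 'p::finite) set)"
proof -
  have "t $ k \<le> 1" if "t \<in> std_simplex" for t :: "real ^ 'p" and k
    using that member_le_sum[of k UNIV "\<lambda>k. t $ k"]
    by (auto simp: std_simplex_def nonneg_vecs_def)
  then have "(std_simplex :: (real ^ 'p) set) \<subseteq> cbox 0 1"
    by (auto simp: mem_box_cart std_simplex_def nonneg_vecs_def)
  then have "bounded (std_simplex :: (real ^ 'p) set)"
    using bounded_cbox bounded_subset by blast
  moreover have "closed (std_simplex :: (real ^ 'p) set)"
  proof -
    have eq: "std_simplex = {t :: real ^ 'p. \<forall>k. 0 \<le> t $ k} \<inter> {t. (\<Sum>k\<in>UNIV. t $ k) = 1}"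
      by (auto simp: std_simplex_def nonneg_vecs_def)
    show ?thesis
      unfolding eq
      by (intro closed_Int closed_Collect_all closed_Collect_le closed_Collect_eq continuous_intros)
  qed
  ultimately show ?thesis
    by (simp add: compact_eq_bounded_closed)
qed

lemma nonneg_vecs_normalize:
  assumes "v \<in> nonneg_vecs"
  obtains c t where "0 \<le> c" "t \<in> std_simplex" "v = c *\<^sub>R t"
proof (cases "v = 0")
  case True
  have "axis undefined 1 \<in> std_simplex"
    by (simp add: std_simplex_def nonneg_vecs_def axis_def)
  with True that[of 0 "axis undefined 1"] show ?thesis by simp
next
  case False
  let ?c = "\<Sum>k\<in>UNIV. v $ k"
  have nonneg: "0 \<le> v $ k" for k
    using assms by (simp add: nonneg_vecs_def)
  from False obtain k where "v $ k \<noteq> 0"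
    by (auto simp: vec_eq_iff)
  with nonneg have "0 < ?c"
    by (intro sum_pos2[of UNIV k]) (auto simp: less_le)
  moreover from this nonneg have "(1 / ?c) *\<^sub>R v \<in> std_simplex"
    by (simp add: std_simplex_def nonneg_vecs_def sum_divide_distrib[symmetric])
  ultimately show ?thesis
    using that[of ?c "(1 / ?c) *\<^sub>R v"] by simp
qed

lemma COP_iff_simplex:
  "D \<in> COP \<longleftrightarrow> D \<in> sym_mats \<and> (\<forall>t\<in>std_simplex. 0 \<le> t \<bullet> (D *v t))"
proof (intro iffI conjI)
  assume D: "D \<in> sym_mats \<and> (\<forall>t\<in>std_simplex. 0 \<le> t \<bullet> (D *v t))"
  have "0 \<le> v \<bullet> (D *v v)" if v: "v \<in> nonneg_vecs" for v
  proof -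
    obtain c t where "t \<in> std_simplex" "v = c *\<^sub>R t"
      using nonneg_vecs_normalize[OF v] by metis
    with D show ?thesis
      by (simp only: quadratic_form_scaleR) simp
  qed
  with D show "D \<in> COP" by (simp add: COP_def)
qed (auto simp: COP_def std_simplex_def)

text \<open>
  A zero of the form minimizes it on the orthant, so its gradient there is nonnegative; concretely,
  a negative entry of \<open>Y *v t\<close> would make the form negative after a small move along \<open>axis k 1\<close>.
\<close>

lemma copositive_gradient_nonneg:
  assumes Y: "Y \<in> COP" and t: "t \<in> nonneg_vecs" "t \<bullet> (Y *v t) = 0"
  shows "0 \<le> (Y *v t) $ k"
proof (rule ccontr)
  assume "\<not> 0 \<le> (Y *v t) $ k"
  define g where "g = - (Y *v t) $ k"
  define h where "h = axis k 1 \<bullet> (Y *v axis k 1)"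
  \<comment> \<open>the step is short enough for the linear term \<open>2 * e * g\<close> to dominate \<open>e\<^sup>2 * h\<close>\<close>
  define e where "e = g / (\<bar>h\<bar> + 1)"
  have "0 < g" using \<open>\<not> 0 \<le> (Y *v t) $ k\<close> by (simp add: g_def)
  then have "0 < e" by (simp add: e_def)
  have sym: "Y \<in> sym_mats" using Y by (simp add: COP_def)
  have "t + e *\<^sub>R axis k 1 \<in> nonneg_vecs"
    using t(1) \<open>0 < e\<close> by (auto simp: nonneg_vecs_def axis_def)
  then have "0 \<le> (t + e *\<^sub>R axis k 1) \<bullet> (Y *v (t + e *\<^sub>R axis k 1))"
    using Y by (simp add: COP_def)
  also have "\<dots> = 2 * (t \<bullet> (Y *v (e *\<^sub>R axis k 1))) + e\<^sup>2 * h"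
    unfolding quadratic_form_add[OF sym] quadratic_form_scaleR t(2) h_def by simp
  also have "t \<bullet> (Y *v (e *\<^sub>R axis k 1)) = - e * g"
    unfolding form_commute[OF sym, of t] by (simp add: g_def inner_axis_form)
  also have "2 * (- e * g) + e\<^sup>2 * h = e * (e * h - 2 * g)"
    by (simp add: algebra_simps power2_eq_square)
  finally have "2 * g \<le> e * h"
    using \<open>0 < e\<close> by (simp add: zero_le_mult_iff)
  also have "e * h \<le> e * \<bar>h\<bar>"
    using \<open>0 < e\<close> by (intro mult_left_mono) auto
  also have "\<dots> \<le> e * (\<bar>h\<bar> + 1)"
    using \<open>0 < e\<close> by simp
  also have "\<dots> = g"
    by (simp add: e_def add_nonneg_eq_0_iff)
  finally show False using \<open>0 < g\<close> by simp
qed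

text \<open>
  Complementary slackness: the products of the entries are nonnegative and add up to zero.
\<close>

lemma inner_zero_on_support:
  assumes "\<And>k. 0 \<le> w $ k" "t \<in> nonneg_vecs" "t \<bullet> w = 0" "t $ k \<noteq> 0"
  shows "w $ k = 0"
proof -
  have "(\<Sum>k\<in>UNIV. t $ k * w $ k) = 0" "\<And>k. 0 \<le> t $ k * w $ k"
    using assms(1,2,3) by (auto simp: inner_vec_def nonneg_vecs_def)
  then have "t $ k * w $ k = 0"
    by (simp add: sum_nonneg_eq_0_iff)
  with assms(4) show ?thesis by simp
qed

text \<open>
  The first-order condition at a minimizer, obtained without multipliers: subtracting the minimal
  value from every entry of \<open>G\<close> subtracts it from the form on the whole simplex, which makes the
  matrix copositive with zero \<open>t\<close>.
\<close>

lemma simplex_minimizer_gradient_eq: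
  assumes G: "G \<in> sym_mats" and t: "t \<in> std_simplex" and
    min: "\<And>u. u \<in> std_simplex \<Longrightarrow> t \<bullet> (G *v t) \<le> u \<bullet> (G *v u)" and
    supp: "t $ k \<noteq> 0"
  shows "(G *v t) $ k = t \<bullet> (G *v t)"
proof -
  define \<mu> where "\<mu> = t \<bullet> (G *v t)"
  define E :: "real ^ 'a ^ 'a" where "E = (\<chi> i j. - \<mu>)"
  have E_vec: "(E *v u) $ k = - \<mu>" if "u \<in> std_simplex" for u k
    using that
    by (simp add: E_def matrix_vector_mult_def sum_distrib_left[symmetric] std_simplex_def sum_negf)
  have E_form: "u \<bullet> (E *v u) = - \<mu>" if "u \<in> std_simplex" for u
    using that
    by (simp add: form_eq_sum E_vec sum_distrib_right[symmetric] std_simplex_def sum_negf)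
  have "E \<in> sym_mats"
    by (simp add: sym_mats_def E_def transpose_def vec_eq_iff)
  then have "G + E \<in> sym_mats"
    using G subspace_add subspace_sym_mats by blast
  moreover have "0 \<le> u \<bullet> ((G + E) *v u)" if "u \<in> std_simplex" for u
    using min[OF that] E_form[OF that] by (simp add: form_simps \<mu>_def)
  ultimately have GE: "G + E \<in> COP"
    by (simp add: COP_iff_simplex)
  have zero: "t \<bullet> ((G + E) *v t) = 0"
    using E_form[OF t] by (simp add: form_simps \<mu>_def)
  have t_nonneg: "t \<in> nonneg_vecs"
    using t by (simp add: std_simplex_def)
  have "((G + E) *v t) $ k = 0"
    using copositive_gradient_nonneg[OF GE t_nonneg zero] t_nonneg zero supp
    by (rule inner_zero_on_support)
  with E_vec[OF t, of k] show ?thesis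
    by (simp add: form_simps \<mu>_def)
qed

text \<open>
  A zero of \<open>f\<close> inside a segment on which \<open>f\<close> is nonnegative forces \<open>f\<close> to vanish at both ends, so no
  new constraint arises at interior points. Membership of a convex hull in such a set gives
  conclusions about precisely those of its points at which \<open>f\<close> vanishes.
\<close>

lemma convex_nonneg_with_zeros_in:
  fixes f :: "'a::real_vector \<Rightarrow> real"
  assumes "linear f" "convex H"
  shows "convex {x. 0 \<le> f x \<and> (f x = 0 \<longrightarrow> x \<in> H)}"
  unfolding convex_alt
proof clarify
  fix u v and s :: real
  assume u: "0 \<le> f u" "f u = 0 \<longrightarrow> u \<in> H" and v: "0 \<le> f v" "f v = 0 \<longrightarrow> v \<in> H"
    and s: "0 \<le> s" "s \<le> 1"
  let ?w = "(1 - s) *\<^sub>R u + s *\<^sub>R v"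
  have fw: "f ?w = (1 - s) * f u + s * f v"
    using assms(1) by (simp add: linear_add linear_scale)
  have nonneg: "0 \<le> (1 - s) * f u" "0 \<le> s * f v"
    using u(1) v(1) s by auto
  have "?w \<in> H" if "f ?w = 0"
  proof -
    have "(1 - s) * f u = 0" "s * f v = 0"
      using nonneg fw that by linarith+
    then consider "s = 0" "u \<in> H" | "s = 1" "v \<in> H" | "u \<in> H" "v \<in> H"
      using u(2) v(2) by (cases "s = 0"; cases "s = 1") auto
    then show ?thesis
      using assms(2) s by cases (auto simp: convex_alt)
  qed
  with fw nonneg show "0 \<le> f ?w \<and> (f ?w = 0 \<longrightarrow> ?w \<in> H)"
    by simp
qed

section \<open>Feasible directions, tangent space and exposed faces\<close>

text \<open>
  If \<open>D\<close> is not a feasible direction, no \<open>Y + e i *\<^sub>R D\<close> with \<open>e i > 0\<close> is copositive; take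
  \<open>e i \<longlonglongrightarrow> 0\<close>. Let \<open>t i\<close> minimize its form on the simplex, with value
  \<open>\<mu> i < 0\<close>, and let \<open>l\<close> be a limit point of the minimizers; it is a zero of \<open>Y\<close>. The first-order
  condition at \<open>t i\<close> has two consequences for late \<open>i\<close>. Since the support of \<open>l\<close> lies in that of \<open>t i\<close>, the
  mixed form of \<open>l\<close> and \<open>t i\<close> equals \<open>\<mu> i < 0\<close>. And \<open>t i\<close> vanishes wherever the gradient \<open>Y *v l\<close> is
  positive, so the contribution of \<open>Y\<close> to the mixed form is zero while that of \<open>D\<close> is nonnegative: a
  contradiction.
\<close>

lemma dir_COP_if_gradient_nonneg:
  fixes D Y :: "real ^ 'p::finite ^ 'p"
  assumes Y: "Y \<in> COP" and D: "D \<in> sym_mats"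
    and V: "V \<subseteq> simplex_zeros Y" "simplex_zeros Y \<subseteq> convex hull V"
    and grad: "\<And>v k. v \<in> V \<Longrightarrow> (Y *v v) $ k = 0 \<Longrightarrow> 0 \<le> (D *v v) $ k"
  shows "D \<in> dir_COP Y"
proof (rule ccontr)
  assume no_dir: "D \<notin> dir_COP Y"
  define e where "e i = inverse (real (Suc i))" for i
  define G where "G i = Y + e i *\<^sub>R D" for i
  have e_pos: "0 < e i" for i by (simp add: e_def)
  have Ysym: "Y \<in> sym_mats" using Y by (simp add: COP_def)
  have G_sym: "G i \<in> sym_mats" for i
    unfolding G_def using Ysym D subspace_sym_mats by (intro subspace_add subspace_scale)
  have G_not_COP: "G i \<notin> COP" for i
    using no_dir D e_pos by (auto simp: dir_COP_def G_def)
  have ne: "(std_simplex :: (real ^ 'p) set) \<noteq> {}"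
    using G_not_COP[of 0] G_sym by (auto simp: COP_iff_simplex)
  have "\<exists>t\<in>std_simplex. \<forall>u\<in>std_simplex. t \<bullet> (G i *v t) \<le> u \<bullet> (G i *v u)" for i
    using continuous_attains_inf[OF compact_std_simplex ne continuous_on_quadratic_form] .
  then obtain t where t: "\<And>i. t i \<in> std_simplex"
    and t_min: "\<And>i u. u \<in> std_simplex \<Longrightarrow> t i \<bullet> (G i *v t i) \<le> u \<bullet> (G i *v u)"
    by metis
  define \<mu> where "\<mu> i = t i \<bullet> (G i *v t i)" for i
  have \<mu>_neg: "\<mu> i < 0" for i
  proof -
    obtain u where "u \<in> std_simplex" "u \<bullet> (G i *v u) < 0"
      using G_not_COP[of i] G_sym[of i] by (auto simp: COP_iff_simplex not_le)
    with t_min[of u i] show ?thesis by (simp add: \<mu>_def)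
  qed
  \<comment> \<open>on the support of the minimizer the gradient is constant\<close>
  have KKT: "t i $ k \<noteq> 0 \<Longrightarrow> (G i *v t i) $ k = \<mu> i" for i k
    unfolding \<mu>_def by (rule simplex_minimizer_gradient_eq[OF G_sym t t_min])
  \<comment> \<open>pass to a convergent subsequence of the minimizers\<close>
  obtain l r where l: "l \<in> std_simplex" "strict_mono r" "(t \<circ> r) \<longlonglongrightarrow> l"
    using compact_std_simplex t unfolding compact_def by metis
  have "e \<longlonglongrightarrow> 0"
    unfolding e_def by (rule LIMSEQ_inverse_real_of_nat)
  then have e_lim: "(\<lambda>i. e (r i)) \<longlonglongrightarrow> 0"
    using l(2) LIMSEQ_subseq_LIMSEQ[of e 0 r] by (simp add: o_def)
  have t_lim: "(\<lambda>i. t (r i)) \<longlonglongrightarrow> l"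
    using l(3) by (simp add: o_def)
  have mult_lim: "(\<lambda>i. M *v t (r i)) \<longlonglongrightarrow> M *v l" for M :: "real ^ 'p ^ 'p"
    by (rule bounded_linear.tendsto[OF matrix_vector_mul_bounded_linear t_lim])
  have Gt_lim: "(\<lambda>i. G (r i) *v t (r i)) \<longlonglongrightarrow> Y *v l"
  proof -
    have "(\<lambda>i. Y *v t (r i) + e (r i) *\<^sub>R (D *v t (r i))) \<longlonglongrightarrow> Y *v l + 0 *\<^sub>R (D *v l)"
      by (intro tendsto_intros mult_lim e_lim)
    then show ?thesis by (simp add: G_def form_simps)
  qed
  have "(\<lambda>i. \<mu> (r i)) \<longlonglongrightarrow> l \<bullet> (Y *v l)"
    unfolding \<mu>_def by (intro tendsto_inner t_lim Gt_lim)
  then have "l \<bullet> (Y *v l) \<le> 0"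
    using \<mu>_neg by (intro LIMSEQ_le_const2) (auto intro: less_imp_le)
  moreover have "0 \<le> l \<bullet> (Y *v l)"
    using Y l(1) by (auto simp: COP_iff_simplex)
  ultimately have l_zero: "l \<in> simplex_zeros Y"
    using l(1) by (simp add: simplex_zeros_def)
  have Yl: "0 \<le> (Y *v l) $ k" for k
    using copositive_gradient_nonneg[OF Y] simplex_zerosD[OF l_zero] by blast
  have "\<forall>\<^sub>F i in sequentially. (l $ k \<noteq> 0 \<longrightarrow> t (r i) $ k \<noteq> 0) \<and>
      ((Y *v l) $ k \<noteq> 0 \<longrightarrow> t (r i) $ k = 0)" for k
  proof -
    have "\<forall>\<^sub>F i in sequentially. l $ k \<noteq> 0 \<longrightarrow> t (r i) $ k \<noteq> 0"
      using tendsto_imp_eventually_ne[OF tendsto_vec_nth[OF t_lim, of k], of 0] by (cases "l $ k = 0") auto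
    moreover have "\<forall>\<^sub>F i in sequentially. (Y *v l) $ k \<noteq> 0 \<longrightarrow> t (r i) $ k = 0"
    proof (cases "(Y *v l) $ k = 0")
      case False
      with Yl[of k] have "0 < (Y *v l) $ k" by simp
      then have "\<forall>\<^sub>F i in sequentially. 0 < (G (r i) *v t (r i)) $ k"
        by (intro order_tendstoD(1)[OF tendsto_vec_nth[OF Gt_lim]])
      then show ?thesis
      proof eventually_elim
        case (elim i)
        with KKT[of "r i" k] \<mu>_neg[of "r i"] show ?case by auto
      qed
    qed simp
    ultimately show ?thesis by eventually_elim simp
  qed
  then have "\<forall>\<^sub>F i in sequentially. \<forall>k. (l $ k \<noteq> 0 \<longrightarrow> t (r i) $ k \<noteq> 0) \<and>
      ((Y *v l) $ k \<noteq> 0 \<longrightarrow> t (r i) $ k = 0)"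
    by (simp add: eventually_all_finite)
  then obtain i where supp: "\<And>k. l $ k \<noteq> 0 \<Longrightarrow> t (r i) $ k \<noteq> 0"
      "\<And>k. (Y *v l) $ k \<noteq> 0 \<Longrightarrow> t (r i) $ k = 0"
    unfolding eventually_sequentially by blast
  let ?t = "t (r i)"
  \<comment> \<open>the hypothesis on the generators in \<open>V\<close> extends to their convex hull, hence to \<open>l\<close>\<close>
  have Dl: "0 \<le> (D *v l) $ k" if Yl_0: "(Y *v l) $ k = 0" for k
  proof -
    let ?W = "{u. 0 \<le> (Y *v u) $ k \<and> ((Y *v u) $ k = 0 \<longrightarrow> u \<in> {u. 0 \<le> (D *v u) $ k})}"
    have lin: "linear (\<lambda>u. (M *v u) $ k)" for M :: "real ^ 'p ^ 'p"
      by (rule linearI) (simp_all add: form_simps)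
    have "convex ?W"
      using lin by (intro convex_nonneg_with_zeros_in) (auto simp: convex_alt form_simps)
    moreover have "V \<subseteq> ?W"
      using copositive_gradient_nonneg[OF Y] simplex_zerosD(1,3) V(1) grad by blast
    ultimately have "convex hull V \<subseteq> ?W"
      by (rule hull_minimal[rotated])
    with V(2) l_zero Yl_0 show ?thesis by blast
  qed
  have "l \<bullet> (G (r i) *v ?t) = (\<Sum>k\<in>UNIV. l $ k * \<mu> (r i))"
    unfolding form_eq_sum using supp(1) KKT[of "r i"] by (intro sum.cong) auto
  also have "\<dots> = \<mu> (r i)"
    using l(1) by (simp add: sum_distrib_right[symmetric] std_simplex_def)
  finally have "l \<bullet> (Y *v ?t) + e (r i) * (l \<bullet> (D *v ?t)) < 0"
    using \<mu>_neg[of "r i"] by (simp add: G_def form_simps)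
  moreover have "l \<bullet> (Y *v ?t) = 0"
  proof -
    have "?t $ k * (Y *v l) $ k = 0" for k
      using supp(2)[of k] by auto
    then show ?thesis
      unfolding form_commute[OF Ysym, of l ?t] form_eq_sum[of ?t]
      by (intro sum.neutral) blast
  qed
  moreover have "0 \<le> l \<bullet> (D *v ?t)"
    unfolding form_commute[OF D, of l ?t] form_eq_sum[of ?t]
  proof (intro sum_nonneg)
    fix k
    show "0 \<le> ?t $ k * (D *v l) $ k"
      using supp(2)[of k] Dl[of k] t[of "r i"]
      by (cases "(Y *v l) $ k = 0") (auto simp: std_simplex_def nonneg_vecs_def)
  qed
  ultimately show False
    using e_pos[of "r i"] by (auto simp: mult_less_0_iff)
qed


text \<open>
  Where the form of \<open>D\<close> is nonpositive, compactness bounds the form of \<open>Y\<close> away from zero, and a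
  small multiple of \<open>D\<close> cannot consume this bound; elsewhere adding \<open>D\<close> only helps.
\<close>

lemma dir_COP_if_positive_on_zeros:
  fixes D Y :: "real ^ 'p::finite ^ 'p"
  assumes Y: "Y \<in> COP" and D: "D \<in> sym_mats"
    and pos: "\<And>t. t \<in> simplex_zeros Y \<Longrightarrow> 0 < t \<bullet> (D *v t)"
  shows "D \<in> dir_COP Y"
proof -
  define K where "K = std_simplex \<inter> {t. t \<bullet> (D *v t) \<le> 0}"
  have "closed {t. t \<bullet> (D *v t) \<le> 0}"
    by (intro closed_Collect_le continuous_intros)
  then have "compact K"
    unfolding K_def using compact_std_simplex by (intro compact_Int_closed)
  have "\<exists>e>0. \<forall>t\<in>K. 0 \<le> t \<bullet> ((Y + e *\<^sub>R D) *v t)"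
  proof (cases "K = {}")
    case True
    then show ?thesis by (auto intro: exI[of _ 1])
  next
    case False
    from continuous_attains_inf[OF \<open>compact K\<close> False continuous_on_quadratic_form]
    obtain a where a: "a \<in> K" "\<And>t. t \<in> K \<Longrightarrow> a \<bullet> (Y *v a) \<le> t \<bullet> (Y *v t)"
      by metis
    from continuous_attains_inf[OF \<open>compact K\<close> False continuous_on_quadratic_form]
    obtain b where b: "b \<in> K" "\<And>t. t \<in> K \<Longrightarrow> b \<bullet> (D *v b) \<le> t \<bullet> (D *v t)"
      by metis
    define c where "c = a \<bullet> (Y *v a)"
    define d where "d = \<bar>b \<bullet> (D *v b)\<bar> + 1"
    have "a \<notin> simplex_zeros Y"
      using pos[of a] a(1) by (auto simp: K_def)
    moreover have "0 \<le> c"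
      using Y a(1) by (auto simp: K_def COP_iff_simplex c_def)
    ultimately have "0 < c"
      using a(1) by (auto simp: simplex_zeros_def K_def c_def less_le)
    have "0 < d" by (simp add: d_def)
    have "0 \<le> t \<bullet> ((Y + (c / d) *\<^sub>R D) *v t)" if "t \<in> K" for t
    proof -
      have "- d \<le> t \<bullet> (D *v t)"
        using b(2)[OF that] by (simp add: d_def)
      then have "(c / d) * (- d) \<le> (c / d) * (t \<bullet> (D *v t))"
        using \<open>0 < c\<close> \<open>0 < d\<close> by (intro mult_left_mono) auto
      moreover have "(c / d) * (- d) = - c"
        using \<open>0 < d\<close> by simp
      ultimately show ?thesis
        using a(2)[OF that] by (simp add: form_simps c_def)
    qed
    then show ?thesis
      using \<open>0 < c\<close> \<open>0 < d\<close> by (intro exI[of _ "c / d"]) simp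
  qed
  then obtain e where e: "e > 0" "\<And>t. t \<in> K \<Longrightarrow> 0 \<le> t \<bullet> ((Y + e *\<^sub>R D) *v t)"
    by blast
  have "0 \<le> t \<bullet> ((Y + e *\<^sub>R D) *v t)" if "t \<in> std_simplex" for t
  proof (cases "t \<in> K")
    case False
    with that have "0 < t \<bullet> (D *v t)" "0 \<le> t \<bullet> (Y *v t)"
      using Y by (auto simp: K_def COP_iff_simplex)
    with e(1) show ?thesis by (simp add: form_simps)
  qed (rule e(2))
  moreover have "Y + e *\<^sub>R D \<in> sym_mats"
    using Y D subspace_sym_mats by (auto simp: COP_def intro: subspace_add subspace_scale)
  ultimately have "Y + e *\<^sub>R D \<in> COP"
    by (simp add: COP_iff_simplex)
  with D e(1) show ?thesis
    by (auto simp: dir_COP_def)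
qed

text \<open>
  Adding a small multiple of the all-ones matrix, whose form is \<open>1\<close> on the simplex, turns
  nonnegativity on the zeros into positivity, so that the previous lemma applies.
\<close>

lemma closure_dir_COP:
  fixes Y :: "real ^ 'p::finite ^ 'p"
  assumes Y: "Y \<in> COP"
  shows "closure (dir_COP Y) = {D \<in> sym_mats. \<forall>t\<in>simplex_zeros Y. 0 \<le> t \<bullet> (D *v t)}"
    (is "_ = ?H")
proof (rule subset_antisym)
  have "?H = sym_mats \<inter> (\<Inter>t\<in>simplex_zeros Y. {D. 0 \<le> sq_outer t \<bullet>\<bullet> D})"
    by (auto simp: mdot_commute[of "sq_outer _"] mdot_sq_outer)
  moreover have "closed {D. 0 \<le> sq_outer t \<bullet>\<bullet> D}" for t :: "real ^ 'p"
    by (intro closed_Collect_le continuous_intros linear_continuous_on)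
      (simp add: linear_mdot linear_conv_bounded_linear[symmetric])
  ultimately have "closed ?H"
    by (simp add: closed_Int closed_INT closed_subspace[OF subspace_sym_mats])
  moreover have "dir_COP Y \<subseteq> ?H"
  proof
    fix D assume "D \<in> dir_COP Y"
    then obtain e where "D \<in> sym_mats" "0 < e" and YD: "Y + e *\<^sub>R D \<in> COP"
      by (auto simp: dir_COP_def)
    moreover have "0 \<le> t \<bullet> (D *v t)" if "t \<in> simplex_zeros Y" for t
    proof -
      have "0 \<le> t \<bullet> ((Y + e *\<^sub>R D) *v t)"
        using YD simplex_zerosD(2)[OF that] by (simp add: COP_iff_simplex)
      with simplex_zerosD(3)[OF that] \<open>0 < e\<close> show ?thesis
        by (simp add: form_simps zero_le_mult_iff)
    qed
    ultimately show "D \<in> ?H" by simp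
  qed
  ultimately show "closure (dir_COP Y) \<subseteq> ?H"
    by (intro closure_minimal)
next
  show "?H \<subseteq> closure (dir_COP Y)"
  proof
    fix D assume D: "D \<in> ?H"
    define E :: "real ^ 'p ^ 'p" where "E = (\<chi> i j. 1)"
    have E_sym: "E \<in> sym_mats"
      by (simp add: sym_mats_def E_def transpose_def vec_eq_iff)
    have E_form: "t \<bullet> (E *v t) = 1" if "t \<in> std_simplex" for t
    proof -
      have "(E *v t) $ k = 1" for k
        using that by (simp add: E_def matrix_vector_mult_def std_simplex_def)
      with that show ?thesis
        by (simp add: form_eq_sum std_simplex_def)
    qed
    show "D \<in> closure (dir_COP Y)"
      unfolding closure_approachable
    proof (intro allI impI)
      fix e :: real assume "0 < e"
      define d where "d = e / (norm E + 1)"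
      have "0 < norm E + 1"
        by (simp add: add_nonneg_pos)
      with \<open>0 < e\<close> have "0 < d"
        by (simp add: d_def)
      have "D + d *\<^sub>R E \<in> sym_mats"
        using D E_sym subspace_sym_mats by (auto intro: subspace_add subspace_scale)
      moreover have "0 < t \<bullet> ((D + d *\<^sub>R E) *v t)" if "t \<in> simplex_zeros Y" for t
        using D that E_form[OF simplex_zerosD(2)[OF that]] \<open>0 < d\<close>
        by (simp add: form_simps add_nonneg_pos)
      ultimately have "D + d *\<^sub>R E \<in> dir_COP Y"
        by (rule dir_COP_if_positive_on_zeros[OF Y])
      moreover have "dist (D + d *\<^sub>R E) D < e"
      proof -
        have "dist (D + d *\<^sub>R E) D = d * norm E"
          using \<open>0 < d\<close> by (simp add: dist_norm)
        also have "\<dots> < d * (norm E + 1)"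
          using \<open>0 < d\<close> by simp
        also have "\<dots> = e"
          using \<open>0 < norm E + 1\<close> by (simp add: d_def)
        finally show ?thesis .
      qed
      ultimately show "\<exists>D'\<in>dir_COP Y. dist D' D < e" by blast
    qed
  qed
qed

lemma uminus_in_sym_mats_iff: "- D \<in> sym_mats \<longleftrightarrow> D \<in> sym_mats"
  using subspace_neg[OF subspace_sym_mats, of D] subspace_neg[OF subspace_sym_mats, of "- D"]
  by auto

lemma in_uminus_image_iff: "x \<in> uminus ` S \<longleftrightarrow> - x \<in> S" for x :: "'a::group_add"
  by (metis imageE image_eqI minus_minus)

lemma matrix_vector_mult_uminus: "(- D) *v t = - (D *v t)" for D :: "real ^ 'p::finite ^ 'p"
  using scaleR_matrix_vector_assoc[of "- 1" D t] by simp

text \<open>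
  The tangent space sees the zeros only through the quadratic form of \<open>D\<close>; the lineality space of the
  feasible directions, described next, also sees the gradients \<open>D *v v\<close>. The gap between the two is
  what the conditions B1 and B2 control.
\<close>

lemma tan_COP_eq:
  assumes "Y \<in> COP"
  shows "tan_COP Y = {D \<in> sym_mats. \<forall>t\<in>simplex_zeros Y. t \<bullet> (D *v t) = 0}"
  by (auto simp: tan_COP_def closure_dir_COP[OF assms] in_uminus_image_iff uminus_in_sym_mats_iff
      matrix_vector_mult_uminus intro: antisym)

lemma ldir_COP_eq:
  assumes Y: "Y \<in> COP" and V: "V \<subseteq> simplex_zeros Y" "simplex_zeros Y \<subseteq> convex hull V"
  shows "ldir_COP Y = {D \<in> sym_mats. \<forall>v\<in>V. \<forall>k. (Y *v v) $ k = 0 \<longrightarrow> (D *v v) $ k = 0}"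
    (is "_ = ?L")
proof (rule subset_antisym)
  show "?L \<subseteq> ldir_COP Y"
  proof
    fix D assume "D \<in> ?L"
    then have "D \<in> dir_COP Y" "- D \<in> dir_COP Y"
      by (auto intro!: dir_COP_if_gradient_nonneg[OF Y _ V]
          simp: uminus_in_sym_mats_iff matrix_vector_mult_uminus)
    then show "D \<in> ldir_COP Y"
      by (simp add: ldir_COP_def in_uminus_image_iff)
  qed
next
  have grad: "0 \<le> (D *v v) $ k"
    if D: "D \<in> dir_COP Y" "v \<bullet> (D *v v) = 0" and v: "v \<in> V" "(Y *v v) $ k = 0" for D v k
  proof -
    obtain e where e: "0 < e" "Y + e *\<^sub>R D \<in> COP"
      using D(1) by (auto simp: dir_COP_def)
    have "v \<in> nonneg_vecs" "v \<bullet> (Y *v v) = 0"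
      using v(1) V(1) simplex_zerosD by blast+
    then have "0 \<le> ((Y + e *\<^sub>R D) *v v) $ k"
      using D(2) by (intro copositive_gradient_nonneg[OF e(2)]) (simp_all add: form_simps)
    with v(2) e(1) show ?thesis
      by (simp add: form_simps zero_le_mult_iff)
  qed
  show "ldir_COP Y \<subseteq> ?L"
  proof
    fix D assume "D \<in> ldir_COP Y"
    then have D: "D \<in> dir_COP Y" "- D \<in> dir_COP Y"
      by (auto simp: ldir_COP_def in_uminus_image_iff)
    then have "D \<in> tan_COP Y"
      using closure_subset[of "dir_COP Y"] by (auto simp: tan_COP_def in_uminus_image_iff)
    then have sym: "D \<in> sym_mats" and zero: "\<And>v. v \<in> V \<Longrightarrow> v \<bullet> (D *v v) = 0"
      using V(1) by (auto simp: tan_COP_eq[OF Y])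
    have "(D *v v) $ k = 0" if v: "v \<in> V" "(Y *v v) $ k = 0" for v k
      using grad[OF D(1) zero[OF v(1)] v] grad[OF D(2) _ v] zero[OF v(1)]
      by (simp add: matrix_vector_mult_uminus)
    with sym show "D \<in> ?L" by blast
  qed
qed

lemma convex_cone_CP: "convex_cone (CP :: (real ^ 'p::finite ^ 'p) set)"
proof -
  have "conic (sq_outer ` (nonneg_vecs :: (real ^ 'p) set))"
    unfolding conic_def
  proof clarify
    fix t :: "real ^ 'p" and c :: real assume "t \<in> nonneg_vecs" "0 \<le> c"
    have "sqrt c * a * (sqrt c * b) = (sqrt c * sqrt c) * (a * b)" for a b
      by (simp only: mult_ac)
    with \<open>0 \<le> c\<close> have "c *\<^sub>R sq_outer t = sq_outer (sqrt c *\<^sub>R t)"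
      by (simp add: sq_outer_def vec_eq_iff)
    moreover have "sqrt c *\<^sub>R t \<in> nonneg_vecs"
      using \<open>0 \<le> c\<close> \<open>t \<in> nonneg_vecs\<close> by (simp add: nonneg_vecs_def)
    ultimately show "c *\<^sub>R sq_outer t \<in> sq_outer ` nonneg_vecs" by blast
  qed
  then have "(\<lambda>U. c *\<^sub>R U) ` CP \<subseteq> (CP :: (real ^ 'p ^ 'p) set)" if "0 \<le> c" for c
    unfolding CP_def convex_hull_scaling[symmetric]
    using that by (intro hull_mono) (auto simp: conic_def)
  moreover have "sq_outer 0 \<in> (CP :: (real ^ 'p ^ 'p) set)"
    unfolding CP_def by (intro hull_inc) (simp add: nonneg_vecs_def)
  ultimately show ?thesis
    unfolding convex_cone_def conic_def by (auto simp: CP_def)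
qed

text \<open>
  A completely positive matrix is a sum of squares \<open>sq_outer v\<close> with nonnegative \<open>v\<close>, on each of which
  \<open>Y\<close> is nonnegative; if the total is zero, every \<open>v\<close> is a multiple of a zero of \<open>Y\<close>. The induction over
  the sum is replaced by the convexity of \<open>?W\<close>.
\<close>

lemma CP_Int_mat_perp:
  fixes Y :: "real ^ 'p::finite ^ 'p"
  assumes Y: "Y \<in> COP"
  shows "CP \<inter> mat_perp Y = convex_cone hull (sq_outer ` simplex_zeros Y)" (is "_ = ?F")
proof (rule subset_antisym)
  let ?W = "{U. 0 \<le> Y \<bullet>\<bullet> U \<and> (Y \<bullet>\<bullet> U = 0 \<longrightarrow> U \<in> ?F)}"
  have "sq_outer v \<in> ?W" if v_nonneg: "v \<in> nonneg_vecs" for v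
  proof -
    obtain c t where v: "t \<in> std_simplex" "v = c *\<^sub>R t"
      using nonneg_vecs_normalize[OF v_nonneg] by metis
    have outer: "sq_outer v = c\<^sup>2 *\<^sub>R sq_outer t"
      by (simp add: v(2) sq_outer_def vec_eq_iff power2_eq_square)
    have "sq_outer v \<in> ?F" if "Y \<bullet>\<bullet> sq_outer v = 0"
    proof (cases "c = 0")
      case True
      then show ?thesis
        by (simp add: outer convex_cone_hull_contains_0)
    next
      case False
      then have "t \<in> simplex_zeros Y"
        using that v(1) unfolding v(2) mdot_sq_outer quadratic_form_scaleR
        by (simp add: simplex_zeros_def)
      then show ?thesis
        unfolding outer by (intro convex_cone_hull_mul hull_inc) auto
    qed
    moreover have "0 \<le> Y \<bullet>\<bullet> sq_outer v"
      using Y v_nonneg by (simp add: mdot_sq_outer COP_def)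
    ultimately show ?thesis by simp
  qed
  moreover have "convex ?W"
    by (intro convex_nonneg_with_zeros_in linear_mdot convex_convex_cone_hull)
  ultimately have "CP \<subseteq> ?W"
    unfolding CP_def by (intro hull_minimal) auto
  then show "CP \<inter> mat_perp Y \<subseteq> ?F"
    by (auto simp: mat_perp_def)
next
  have "sq_outer t \<in> CP \<inter> mat_perp Y" if "t \<in> simplex_zeros Y" for t
    using simplex_zerosD[OF that]
    by (auto simp: CP_def mat_perp_def sq_outer_in_sym_mats mdot_sq_outer intro: hull_inc)
  moreover have "convex_cone (CP \<inter> mat_perp Y)"
    using convex_cone_CP subspace_sym_mats
    by (auto simp: convex_cone_iff subspace_def mat_perp_def linear_0[OF linear_mdot]
        linear_add[OF linear_mdot] linear_scale[OF linear_mdot])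
  ultimately show "?F \<subseteq> CP \<inter> mat_perp Y"
    by (intro hull_minimal) auto
qed

section \<open>Linear copositive systems\<close>

text \<open>
  The adjoint \<open>\<B>\<^sup>*\<close> of \<open>lin_map A\<close>.
\<close>

definition adj_map :: "('n::finite option \<Rightarrow> real ^ 'p::finite ^ 'p) \<Rightarrow> real ^ 'p ^ 'p \<Rightarrow> real ^ 'n option" where
  "adj_map A U = (\<chi> m. A m \<bullet>\<bullet> U)"

lemma linear_adj_map: "linear (adj_map A)"
  by (rule linearI)
    (simp_all add: adj_map_def vec_eq_iff linear_add[OF linear_mdot] linear_scale[OF linear_mdot])

lemma a_vec_eq_adj_map: "a_vec A t = adj_map A (sq_outer t)"
  by (simp add: a_vec_def adj_map_def mdot_sq_outer)

lemma inner_adj_map: "z \<bullet> adj_map A U = lin_map A z \<bullet>\<bullet> U"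
  by (simp add: adj_map_def lin_map_def inner_vec_def mdot_sum_left mdot_scaleR_left)

lemma inner_a_vec: "z \<bullet> a_vec A t = t \<bullet> (lin_map A z *v t)"
  by (simp add: a_vec_eq_adj_map inner_adj_map mdot_sq_outer)

lemma linear_matrix_entry: "linear (\<lambda>D. (D *v v) $ k)" for v :: "real ^ 'p::finite"
  by (rule linearI) (simp_all add: form_simps)

lemma inner_b_vec: "z \<bullet> b_vec A \<tau> k j = (lin_map A z *v \<tau> j) $ k"
  by (simp add: b_vec_def lin_map_def inner_vec_def[of z] inner_axis_form
      linear_sum[OF linear_matrix_entry] linear_scale[OF linear_matrix_entry])

lemma lin_map_option:
  "lin_map A z = z $ None *\<^sub>R A None + (\<Sum>m\<in>UNIV. z $ Some m *\<^sub>R A (Some m))"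
  by (simp add: lin_map_def UNIV_option_conv sum.reindex)

lemma linear_lin_map: "linear (lin_map A)"
  by (rule linearI) (simp_all add: lin_map_def scaleR_left_distrib sum.distrib scaleR_sum_right)

lemma pencil_eq_lin_map:
  "pencil A x = lin_map A (\<chi> m. case m of None \<Rightarrow> 1 | Some m \<Rightarrow> x $ m)"
  by (simp add: lin_map_option pencil_def)

text \<open>
  The matrices of the system are, up to positive factors, the values of \<open>lin_map A\<close> at vectors whose
  \<open>0\<close>-th coordinate is positive.
\<close>

lemma pencil_dehomogenize:
  assumes "0 < z $ None"
  shows "pencil A (\<chi> m. z $ Some m / z $ None) = (1 / z $ None) *\<^sub>R lin_map A z"
  using assms by (simp add: lin_map_option pencil_def scaleR_right_distrib scaleR_sum_right)

lemma convex_cone_COP: "convex_cone (COP :: (real ^ 'p::finite ^ 'p) set)"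
  using subspace_sym_mats by (auto simp: convex_cone_iff COP_def subspace_def form_simps)

lemma V_pairs_total:
  assumes "i \<in> set js" "j \<in> set js"
  shows "(i, j) \<in> V_pairs js \<or> (j, i) \<in> V_pairs js"
proof -
  obtain k q where "i = js ! k" "k < length js" "j = js ! q" "q < length js"
    using assms by (metis in_set_conv_nth)
  then show ?thesis
    unfolding V_pairs_def by (cases "k \<le> q") auto
qed

lemma V_pairs_subset: "V_pairs js \<subseteq> set js \<times> set js"
  by (auto simp: V_pairs_def)

section \<open>Systems with a maximum slack\<close>

locale copositive_system =
  fixes A :: "'n::finite option \<Rightarrow> real ^ 'p::finite ^ 'p"
    and J :: "'j set" and \<tau> :: "'j \<Rightarrow> real ^ 'p"
    and S :: "'s set" and Js :: "'s \<Rightarrow> 'j list"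
    and Y :: "real ^ 'p ^ 'p"
  assumes sym_A: "\<And>m. A m \<in> sym_mats"
    and max_slack: "max_slack A Y"
    and vertices: "vertex_enumeration A J \<tau>"
    and decomposition: "immobile_decomposition A J \<tau> S Js"
begin

lemma lin_map_in_sym_mats: "lin_map A z \<in> sym_mats"
  unfolding lin_map_def using sym_A subspace_sym_mats
  by (intro subspace_sum subspace_scale)

lemma pencil_feasible_eq: "pencil A ` feasible A = range (pencil A) \<inter> COP"
  by (auto simp: feasible_def)

lemma max_slack_feasible:
  obtains x where "x \<in> feasible A" "Y = pencil A x"
  using max_slack rel_interior_subset[of "pencil A ` feasible A"] by (auto simp: max_slack_def)

lemma max_slack_COP: "Y \<in> COP"
  using max_slack_feasible by (metis (no_types, lifting) feasible_def mem_Collect_eq)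

lemma convex_slacks: "convex (pencil A ` feasible A)"
proof -
  have "convex (range (pencil A))"
    unfolding convex_alt
  proof clarify
    fix x y and u :: real
    have "(1 - u) *\<^sub>R pencil A x + u *\<^sub>R pencil A y = pencil A ((1 - u) *\<^sub>R x + u *\<^sub>R y)"
      by (simp add: pencil_def scaleR_right_distrib scaleR_left_distrib scaleR_left_diff_distrib
          scaleR_right_diff_distrib left_diff_distrib scaleR_sum_right sum.distrib sum_subtractf)
    then show "(1 - u) *\<^sub>R pencil A x + u *\<^sub>R pencil A y \<in> range (pencil A)"
      by simp
  qed
  then show ?thesis
    unfolding pencil_feasible_eq
    using convex_cone_COP by (intro convex_Int) (auto simp: convex_cone_def)
qed

text \<open>
  The reason for working with a maximum slack: a linear functional that is nonnegative on all slacks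
  and vanishes at \<open>Y\<close> vanishes on all of them. Conditions quantified over the feasible set, such as
  membership in \<open>immobile A\<close> or \<open>M_set A \<tau> j\<close>, thus become conditions on \<open>Y\<close> alone.
\<close>

lemma vanishes_on_slacks:
  assumes "linear f" "\<And>x. x \<in> feasible A \<Longrightarrow> 0 \<le> f (pencil A x)" "f Y = 0" "x \<in> feasible A"
  shows "f (pencil A x) = (0 :: real)"
  using linear_constant_if_min_in_rel_interior[OF convex_slacks assms(1), of Y "pencil A x"]
    max_slack assms(2-4) by (auto simp: max_slack_def)

lemma immobile_eq_zeros: "immobile A = simplex_zeros Y"
proof (rule subset_antisym)
  show "immobile A \<subseteq> simplex_zeros Y"
    using max_slack_feasible by (auto simp: immobile_def simplex_zeros_def)
next
  have "t \<bullet> (pencil A x *v t) = 0" if t: "t \<in> simplex_zeros Y" and x: "x \<in> feasible A" for t x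
  proof -
    have "sq_outer t \<bullet>\<bullet> pencil A x = 0"
    proof (rule vanishes_on_slacks[OF linear_mdot _ _ x])
      show "0 \<le> sq_outer t \<bullet>\<bullet> pencil A x" if "x \<in> feasible A" for x
        using that simplex_zerosD(1)[OF t]
        by (auto simp: mdot_commute[of "sq_outer t"] mdot_sq_outer feasible_def COP_def)
      show "sq_outer t \<bullet>\<bullet> Y = 0"
        using simplex_zerosD(3)[OF t] by (simp add: mdot_commute[of "sq_outer t"] mdot_sq_outer)
    qed
    then show ?thesis
      by (simp add: mdot_commute[of "sq_outer t"] mdot_sq_outer)
  qed
  then show "simplex_zeros Y \<subseteq> immobile A"
    by (auto simp: immobile_def simplex_zerosD(2))
qed

lemma vertices_immobile: "\<tau> ` J \<subseteq> simplex_zeros Y"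
  using vertices extreme_point_of_convex_hull
  by (fastforce simp: vertex_enumeration_def bij_betw_def immobile_eq_zeros[symmetric])

lemma piece_subset: "s \<in> S \<Longrightarrow> convex hull (\<tau> ` set (Js s)) \<subseteq> simplex_zeros Y"
  using decomposition by (auto simp: immobile_decomposition_def immobile_eq_zeros[symmetric])

lemma zeros_subset_pieces: "t \<in> simplex_zeros Y \<Longrightarrow> \<exists>s\<in>S. t \<in> convex hull (\<tau> ` set (Js s))"
  using decomposition by (auto simp: immobile_decomposition_def immobile_eq_zeros[symmetric])

lemma zeros_subset_hull: "simplex_zeros Y \<subseteq> convex hull (\<tau> ` J)"
proof
  fix t assume "t \<in> simplex_zeros Y"
  then obtain s where s: "s \<in> S" "t \<in> convex hull (\<tau> ` set (Js s))"
    using zeros_subset_pieces by blast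
  then have "\<tau> ` set (Js s) \<subseteq> \<tau> ` J"
    using decomposition by (auto simp: immobile_decomposition_def)
  then show "t \<in> convex hull (\<tau> ` J)"
    using s(2) hull_mono by blast
qed

lemma M_set_iff:
  assumes "j \<in> J"
  shows "k \<in> M_set A \<tau> j \<longleftrightarrow> (Y *v \<tau> j) $ k = 0"
proof
  assume "k \<in> M_set A \<tau> j"
  moreover obtain x where "x \<in> feasible A" "Y = pencil A x"
    by (rule max_slack_feasible)
  ultimately show "(Y *v \<tau> j) $ k = 0"
    by (auto simp: M_set_def inner_axis_form)
next
  assume Y0: "(Y *v \<tau> j) $ k = 0"
  have "\<tau> j \<in> immobile A"
    using vertices_immobile assms immobile_eq_zeros by blast
  then have "0 \<le> (pencil A x *v \<tau> j) $ k" if "x \<in> feasible A" for x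
    using that by (intro copositive_gradient_nonneg)
      (auto simp: immobile_def feasible_def std_simplex_def)
  then have "(pencil A x *v \<tau> j) $ k = 0" if "x \<in> feasible A" for x
    using vanishes_on_slacks[OF linear_matrix_entry _ Y0 that] by blast
  then show "k \<in> M_set A \<tau> j"
    by (simp add: M_set_def inner_axis_form)
qed

lemma V0_midpoint_immobile:
  assumes "(l, q) \<in> V0 S Js"
  shows "(1/2) *\<^sub>R (\<tau> l + \<tau> q) \<in> simplex_zeros Y"
proof -
  obtain s where s: "s \<in> S" "(l, q) \<in> V_pairs (Js s)"
    using assms by (auto simp: V0_def)
  then have hull: "\<tau> l \<in> convex hull (\<tau> ` set (Js s))" "\<tau> q \<in> convex hull (\<tau> ` set (Js s))"
    using V_pairs_subset[of "Js s"] by (auto intro: hull_inc)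
  have "(1/2) *\<^sub>R (\<tau> l + \<tau> q) \<in> convex hull (\<tau> ` set (Js s))"
    using convexD[OF convex_convex_hull hull, of "1/2" "1/2"] by (simp add: scaleR_right_distrib)
  with piece_subset[OF s(1)] show ?thesis by blast
qed

lemma V0_diagonal: "(l, q) \<in> V0 S Js \<Longrightarrow> (l, l) \<in> V0 S Js \<and> (q, q) \<in> V0 S Js"
  by (fastforce simp: V0_def V_pairs_def)

text \<open>
  Both conditions say that \<open>D\<close> is orthogonal to the span of the matrices \<open>sq_outer t\<close>: expanding a zero
  over the vertices of its piece produces the mixed forms, and polarization at midpoints of vertices,
  which are zeros themselves, isolates each mixed form.
\<close>

lemma V0_forms_zero_iff:
  assumes D: "D \<in> sym_mats"
  shows "(\<forall>(i, j)\<in>V0 S Js. \<tau> i \<bullet> (D *v \<tau> j) = 0) \<longleftrightarrow>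
    (\<forall>t\<in>simplex_zeros Y. t \<bullet> (D *v t) = 0)"
proof
  assume V0: "\<forall>(i, j)\<in>V0 S Js. \<tau> i \<bullet> (D *v \<tau> j) = 0"
  show "\<forall>t\<in>simplex_zeros Y. t \<bullet> (D *v t) = 0"
  proof
    fix t assume "t \<in> simplex_zeros Y"
    then obtain s where s: "s \<in> S" "t \<in> convex hull (\<tau> ` set (Js s))"
      using zeros_subset_pieces by blast
    have "\<tau> i \<bullet> (D *v \<tau> j) = 0" if "(i, j) \<in> V_pairs (Js s)" for i j
      using V0 s(1) that by (fastforce simp: V0_def)
    then have pairs: "\<tau> i \<bullet> (D *v \<tau> j) = 0" if "i \<in> set (Js s)" "j \<in> set (Js s)" for i j
      using V_pairs_total[OF that] form_commute[OF D, of "\<tau> i" "\<tau> j"] by auto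
    have hull_zero: "u \<bullet> w = 0"
      if u: "u \<in> convex hull (\<tau> ` set (Js s))" and w: "\<And>i. i \<in> set (Js s) \<Longrightarrow> \<tau> i \<bullet> w = 0" for u w
    proof -
      have "convex hull (\<tau> ` set (Js s)) \<subseteq> {u. w \<bullet> u = 0}"
        using w by (intro hull_minimal convex_hyperplane) (auto simp: inner_commute)
      with u show ?thesis by (auto simp: inner_commute)
    qed
    have "\<tau> j \<bullet> (D *v t) = 0" if "j \<in> set (Js s)" for j
      unfolding form_commute[OF D, of "\<tau> j"] using s(2) pairs[OF _ that] by (rule hull_zero)
    with s(2) show "t \<bullet> (D *v t) = 0" by (rule hull_zero)
  qed
next
  assume zero: "\<forall>t\<in>simplex_zeros Y. t \<bullet> (D *v t) = 0"
  have half: "\<tau> i \<bullet> (D *v \<tau> i) + 2 * (\<tau> i \<bullet> (D *v \<tau> j)) + \<tau> j \<bullet> (D *v \<tau> j) = 0"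
    if "(i, j) \<in> V0 S Js" for i j
  proof -
    have "((1/2) *\<^sub>R (\<tau> i + \<tau> j)) \<bullet> (D *v ((1/2) *\<^sub>R (\<tau> i + \<tau> j))) = 0"
      using zero V0_midpoint_immobile[OF that] by blast
    then show ?thesis
      unfolding quadratic_form_scaleR quadratic_form_add[OF D] by simp
  qed
  have "\<tau> i \<bullet> (D *v \<tau> j) = 0" if "(i, j) \<in> V0 S Js" for i j
    using half[OF that] half[of i i] half[of j j] V0_diagonal[OF that] by simp
  then show "\<forall>(i, j)\<in>V0 S Js. \<tau> i \<bullet> (D *v \<tau> j) = 0"
    by blast
qed

subsection \<open>The face exposed by the maximum slack and the conditions A1, A2, A3\<close>

text \<open>
  The face of \<open>CP\<close> exposed by \<open>Y\<close>; its image under \<open>adj_map A\<close> is the cone of condition A1.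
\<close>

definition zero_face :: "(real ^ 'p ^ 'p) set" where
  "zero_face = convex_cone hull (sq_outer ` simplex_zeros Y)"

lemma zero_face_eq: "zero_face = CP \<inter> mat_perp Y"
  unfolding zero_face_def by (rule CP_Int_mat_perp[OF max_slack_COP, symmetric])

lemma convex_cone_zero_face: "convex_cone zero_face"
  unfolding zero_face_def by (rule convex_cone_convex_cone_hull)

lemma sq_outer_in_zero_face: "t \<in> simplex_zeros Y \<Longrightarrow> sq_outer t \<in> zero_face"
  unfolding zero_face_def by (intro hull_inc) auto

lemma immobile_cone_eq: "lin_cone (a_vec A ` immobile A) = adj_map A ` zero_face"
proof -
  have "a_vec A ` immobile A = adj_map A ` sq_outer ` simplex_zeros Y"
    by (auto simp: a_vec_eq_adj_map immobile_eq_zeros)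
  then show ?thesis
    by (simp add: lin_cone_eq_convex_cone_hull convex_cone_hull_linear_image[OF linear_adj_map]
        zero_face_def)
qed

lemma nonneg_on_immobile_cone:
  assumes "\<forall>t\<in>simplex_zeros Y. 0 \<le> t \<bullet> (lin_map A z *v t)"
    and "y \<in> lin_cone (a_vec A ` immobile A)"
  shows "0 \<le> z \<bullet> y"
  using assms unfolding lin_cone_eq_convex_cone_hull
  by (intro linear_nonneg_on_convex_cone_hull[where f = "(\<bullet>) z"])
    (auto simp: inner_a_vec immobile_eq_zeros linear_iff inner_add_right)

lemma zero_on_immobile_cone:
  assumes "\<forall>t\<in>simplex_zeros Y. t \<bullet> (lin_map A z *v t) = 0"
    and "y \<in> lin_cone (a_vec A ` immobile A)"
  shows "z \<bullet> y = 0"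
  using assms unfolding lin_cone_eq_convex_cone_hull
  by (intro linear_eq_0_on_convex_cone_hull[where f = "(\<bullet>) z"])
    (auto simp: inner_a_vec immobile_eq_zeros linear_iff inner_add_right)

text \<open>
  Condition A1 seen from the dual side, where it can be compared with A2 and A3.
\<close>

definition forms_balanced :: bool where
  "forms_balanced \<longleftrightarrow> (\<forall>z. (\<forall>t\<in>simplex_zeros Y. 0 \<le> t \<bullet> (lin_map A z *v t)) \<longrightarrow>
     (\<forall>t\<in>simplex_zeros Y. t \<bullet> (lin_map A z *v t) = 0))"

lemma cond_A1_iff: "cond_A1 A \<longleftrightarrow> forms_balanced"
proof -
  let ?C = "lin_cone (a_vec A ` immobile A)"
  have in_C: "a_vec A t \<in> ?C" if "t \<in> simplex_zeros Y" for t
    using that unfolding lin_cone_eq_convex_cone_hull by (intro hull_inc) (simp add: immobile_eq_zeros)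
  have nonneg: "(\<forall>y\<in>?C. 0 \<le> z \<bullet> y) \<longleftrightarrow> (\<forall>t\<in>simplex_zeros Y. 0 \<le> t \<bullet> (lin_map A z *v t))" for z
    using in_C nonneg_on_immobile_cone inner_a_vec by metis
  have zero: "(\<forall>y\<in>?C. z \<bullet> y = 0) \<longleftrightarrow> (\<forall>t\<in>simplex_zeros Y. t \<bullet> (lin_map A z *v t) = 0)" for z
    using in_C zero_on_immobile_cone inner_a_vec by metis
  have "convex_cone ?C"
    by (simp add: lin_cone_eq_convex_cone_hull convex_cone_convex_cone_hull)
  then show ?thesis
    unfolding cond_A1_def forms_balanced_def nonneg[symmetric] zero[symmetric]
    by (rule subspace_convex_cone_iff_dual)
qed

text \<open>
  In a subspace the image of \<open>W\<close> has an opposite. With \<open>W\<close> in the relative interior of the face this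
  produces the matrix of A3, and with \<open>W\<close> the sum over \<open>V0\<close> that of A2.
\<close>

lemma balancing_matrix_if_cond_A1:
  assumes "cond_A1 A" "W \<in> zero_face"
  obtains U where "U \<in> zero_face" "adj_map A (U + W) = 0"
proof -
  have "- adj_map A W \<in> adj_map A ` zero_face"
    using assms unfolding cond_A1_def immobile_cone_eq by (intro subspace_neg) auto
  then obtain U where "U \<in> zero_face" "adj_map A U = - adj_map A W"
    by auto
  then show ?thesis
    using that by (simp add: linear_add[OF linear_adj_map])
qed

text \<open>
  If a matrix in the null space lies in the relative interior of the face, every functional
  \<open>lin_map A z\<close> that is nonnegative on the face attains its minimum \<open>0\<close> there and vanishes on the face.
\<close>

lemma cond_A3_iff: "cond_A3 A Y \<longleftrightarrow> forms_balanced"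
proof
  assume "cond_A3 A Y"
  then obtain U where U: "U \<in> adj_null A" "U \<in> rel_interior zero_face"
    by (auto simp: cond_A3_def strictly_complementary_def zero_face_eq)
  have conv: "convex zero_face"
    using convex_cone_zero_face by (simp add: convex_cone_def)
  have "adj_map A U = 0"
    using U(1) by (simp add: adj_null_def adj_map_def vec_eq_iff)
  show forms_balanced
    unfolding forms_balanced_def
  proof (intro allI impI ballI)
    fix z t assume nonneg: "\<forall>t\<in>simplex_zeros Y. 0 \<le> t \<bullet> (lin_map A z *v t)"
      and t: "t \<in> simplex_zeros Y"
    have U0: "lin_map A z \<bullet>\<bullet> U = 0"
      using \<open>adj_map A U = 0\<close> by (simp add: inner_adj_map[symmetric])
    have "\<forall>W\<in>sq_outer ` simplex_zeros Y. 0 \<le> lin_map A z \<bullet>\<bullet> W"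
      using nonneg by (simp add: mdot_sq_outer)
    then have "\<forall>W\<in>zero_face. lin_map A z \<bullet>\<bullet> U \<le> lin_map A z \<bullet>\<bullet> W"
      unfolding zero_face_def U0 using linear_nonneg_on_convex_cone_hull[OF linear_mdot] by blast
    then have "lin_map A z \<bullet>\<bullet> sq_outer t = lin_map A z \<bullet>\<bullet> U"
      by (rule linear_constant_if_min_in_rel_interior[OF conv linear_mdot U(2) _
          sq_outer_in_zero_face[OF t]])
    with U0 show "t \<bullet> (lin_map A z *v t) = 0"
      by (simp add: mdot_sq_outer)
  qed
next
  assume forms_balanced
  then have A1: "cond_A1 A" by (simp add: cond_A1_iff)
  have conv: "convex zero_face" "zero_face \<noteq> {}"
    using convex_cone_zero_face by (auto simp: convex_cone_def)
  then obtain W where W: "W \<in> rel_interior zero_face"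
    using rel_interior_eq_empty by blast
  then have "W \<in> zero_face"
    using rel_interior_subset by blast
  with A1 obtain U where U: "U \<in> zero_face" "adj_map A (U + W) = 0"
    by (rule balancing_matrix_if_cond_A1)
  have "W + U \<in> rel_interior zero_face"
    using convex_cone_zero_face W U(1) by (rule add_in_rel_interior_convex_cone)
  then have "U + W \<in> rel_interior zero_face"
    by (simp add: add.commute)
  moreover from this have "U + W \<in> CP \<inter> mat_perp Y"
    using rel_interior_subset zero_face_eq by blast
  ultimately show "cond_A3 A Y"
    using U(2) unfolding cond_A3_def strictly_complementary_def
    by (intro bexI[of _ "U + W"])
      (auto simp: zero_face_eq adj_null_def mat_perp_def adj_map_def vec_eq_iff)
qed

lemma finite_V0: "finite (V0 S Js)"
proof -
  have "V0 S Js \<subseteq> (\<Union>s\<in>S. set (Js s) \<times> set (Js s))"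
    using V_pairs_subset by (fastforce simp: V0_def)
  moreover have "finite (\<Union>s\<in>S. set (Js s) \<times> set (Js s))"
    using decomposition by (auto simp: immobile_decomposition_def)
  ultimately show ?thesis by (rule finite_subset)
qed

lemma sq_outer_half_sum:
  "(1/4) *\<^sub>R sq_outer (u + v) = sq_outer ((1/2) *\<^sub>R (u + v))"
  by (simp add: sq_outer_def vec_eq_iff)

text \<open>
  The representation in \<open>lin_cone\<close> is indexed by the matrices themselves and allows zero coefficients;
  A2 asks for positive coefficients and an index set of natural numbers.
\<close>

lemma zero_face_finite_sum:
  assumes "U \<in> zero_face"
  obtains I :: "nat set" and \<alpha> t where "finite I" "\<forall>i\<in>I. 0 < \<alpha> i \<and> t i \<in> simplex_zeros Y"
    "U = (\<Sum>i\<in>I. \<alpha> i *\<^sub>R sq_outer (t i))"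
proof -
  obtain F c where F: "finite F" "F \<subseteq> sq_outer ` simplex_zeros Y" "\<forall>b\<in>F. 0 \<le> c b"
      and U: "U = (\<Sum>b\<in>F. c b *\<^sub>R b)"
    using assms unfolding zero_face_def lin_cone_eq_convex_cone_hull[symmetric] lin_cone_def by blast
  define G where "G = {b \<in> F. 0 < c b}"
  have "finite G" "G \<subseteq> F" using F(1) by (auto simp: G_def)
  then obtain h where h: "bij_betw h {0..<card G} G"
    using ex_bij_betw_nat_finite by blast
  have "\<forall>b\<in>G. \<exists>t\<in>simplex_zeros Y. b = sq_outer t"
    using F(2) by (auto simp: G_def)
  then obtain g where g: "\<And>b. b \<in> G \<Longrightarrow> g b \<in> simplex_zeros Y \<and> b = sq_outer (g b)"
    by metis
  have h_in: "h i \<in> G" if "i \<in> {0..<card G}" for i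
    using h that by (auto simp: bij_betw_def)
  have "U = (\<Sum>b\<in>G. c b *\<^sub>R b)"
    unfolding U using F(1,3) by (intro sum.mono_neutral_right) (auto simp: G_def not_less order_antisym)
  also have "\<dots> = (\<Sum>i\<in>{0..<card G}. c (h i) *\<^sub>R h i)"
    by (rule sum.reindex_bij_betw[OF h, symmetric])
  also have "\<dots> = (\<Sum>i\<in>{0..<card G}. c (h i) *\<^sub>R sq_outer (g (h i)))"
    using g h_in by (intro sum.cong) auto
  finally show ?thesis
    using g h_in by (intro that[of "{0..<card G}" "c \<circ> h" "g \<circ> h"]) (auto simp: G_def)
qed

text \<open>
  The sum over \<open>V0\<close> is chosen so that a functional nonnegative on the zeros can vanish at the matrix of
  A2 only if its form vanishes at all midpoints, hence on all of \<open>V0\<close>.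
\<close>

lemma cond_A2_iff: "cond_A2 A \<tau> S Js \<longleftrightarrow> forms_balanced"
proof
  assume "cond_A2 A \<tau> S Js"
  then obtain U and I :: "nat set" and \<alpha> t where
    I: "finite I" "\<And>i. i \<in> I \<Longrightarrow> 0 < \<alpha> i" "\<And>i. i \<in> I \<Longrightarrow> t i \<in> simplex_zeros Y"
    and U: "U = (\<Sum>i\<in>I. \<alpha> i *\<^sub>R sq_outer (t i))
               + (1 / 4) *\<^sub>R (\<Sum>(l, q)\<in>V0 S Js. sq_outer (\<tau> l + \<tau> q))"
    and null: "\<And>m. A m \<bullet>\<bullet> U = 0"
    unfolding cond_A2_def immobile_eq_zeros by blast
  show forms_balanced
    unfolding forms_balanced_def
  proof (intro allI impI)
    fix z assume nonneg: "\<forall>t\<in>simplex_zeros Y. 0 \<le> t \<bullet> (lin_map A z *v t)"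
    let ?B = "lin_map A z"
    let ?m = "\<lambda>l q. (1/2) *\<^sub>R (\<tau> l + \<tau> q)"
    have mid_nonneg: "0 \<le> ?m l q \<bullet> (?B *v ?m l q)" if "(l, q) \<in> V0 S Js" for l q
      using nonneg V0_midpoint_immobile[OF that] by blast
    have "U = (\<Sum>i\<in>I. \<alpha> i *\<^sub>R sq_outer (t i)) + (\<Sum>(l, q)\<in>V0 S Js. sq_outer (?m l q))"
      unfolding U scaleR_sum_right by (simp only: case_prod_unfold sq_outer_half_sum)
    then have "?B \<bullet>\<bullet> U = (\<Sum>i\<in>I. \<alpha> i * (t i \<bullet> (?B *v t i))) +
        (\<Sum>(l, q)\<in>V0 S Js. ?m l q \<bullet> (?B *v ?m l q))"
      by (simp only: linear_add[OF linear_mdot] linear_sum[OF linear_mdot]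
          linear_scale[OF linear_mdot] mdot_sq_outer case_prod_unfold real_scaleR_def)
    moreover have "?B \<bullet>\<bullet> U = 0"
      using null by (simp add: lin_map_def mdot_sum_left mdot_scaleR_left)
    moreover have "0 \<le> (\<Sum>i\<in>I. \<alpha> i * (t i \<bullet> (?B *v t i)))"
      using I nonneg by (intro sum_nonneg mult_nonneg_nonneg) (auto intro: less_imp_le)
    moreover have "0 \<le> (\<Sum>(l, q)\<in>V0 S Js. ?m l q \<bullet> (?B *v ?m l q))"
      using mid_nonneg by (intro sum_nonneg) auto
    ultimately have "(\<Sum>(l, q)\<in>V0 S Js. ?m l q \<bullet> (?B *v ?m l q)) = 0"
      by linarith
    then have "\<forall>(l, q)\<in>V0 S Js. ?m l q \<bullet> (?B *v ?m l q) = 0"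
      using mid_nonneg by (subst (asm) sum_nonneg_eq_0_iff[OF finite_V0]) auto
    then have mid_zero: "(\<tau> l + \<tau> q) \<bullet> (?B *v (\<tau> l + \<tau> q)) = 0" if "(l, q) \<in> V0 S Js" for l q
      using that unfolding quadratic_form_scaleR by auto
    have diag: "\<tau> l \<bullet> (?B *v \<tau> l) = 0" if "(l, l) \<in> V0 S Js" for l
      using mid_zero[OF that] unfolding quadratic_form_add[OF lin_map_in_sym_mats] by simp
    have "\<tau> l \<bullet> (?B *v \<tau> q) = 0" if "(l, q) \<in> V0 S Js" for l q
      using mid_zero[OF that] diag[of l] diag[of q] V0_diagonal[OF that]
      unfolding quadratic_form_add[OF lin_map_in_sym_mats] by simp
    then show "\<forall>t\<in>simplex_zeros Y. t \<bullet> (?B *v t) = 0"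
      using V0_forms_zero_iff[OF lin_map_in_sym_mats] by blast
  qed
next
  assume forms_balanced
  then have A1: "cond_A1 A" by (simp add: cond_A1_iff)
  let ?W = "(1 / 4) *\<^sub>R (\<Sum>(l, q)\<in>V0 S Js. sq_outer (\<tau> l + \<tau> q))"
  have sum_in: "(\<Sum>x\<in>X. f x) \<in> zero_face" if "finite X" "\<And>x. x \<in> X \<Longrightarrow> f x \<in> zero_face"
    for X :: "('j \<times> 'j) set" and f
    using that
    by (induction X rule: finite_induct)
      (auto intro: convex_cone_add[OF convex_cone_zero_face]
        convex_cone_contains_0[OF convex_cone_zero_face])
  have "?W = (\<Sum>(l, q)\<in>V0 S Js. sq_outer ((1/2) *\<^sub>R (\<tau> l + \<tau> q)))"
    unfolding scaleR_sum_right by (simp only: case_prod_unfold sq_outer_half_sum)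
  also have "\<dots> \<in> zero_face"
    using V0_midpoint_immobile by (intro sum_in finite_V0) (auto intro: sq_outer_in_zero_face)
  finally have W: "?W \<in> zero_face" .
  with A1 obtain U where U: "U \<in> zero_face" "adj_map A (U + ?W) = 0"
    by (rule balancing_matrix_if_cond_A1)
  obtain I :: "nat set" and \<alpha> t where I: "finite I" "\<forall>i\<in>I. 0 < \<alpha> i \<and> t i \<in> simplex_zeros Y"
    "U = (\<Sum>i\<in>I. \<alpha> i *\<^sub>R sq_outer (t i))"
    using zero_face_finite_sum[OF U(1)] by blast
  have "U + ?W \<in> CP"
    using convex_cone_add[OF convex_cone_zero_face U(1) W] by (simp add: zero_face_eq)
  moreover have "\<forall>m. A m \<bullet>\<bullet> (U + ?W) = 0"
    using U(2) by (simp add: adj_map_def vec_eq_iff)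
  moreover have "\<exists>(I :: nat set) \<alpha> t. finite I \<and> (\<forall>i\<in>I. 0 < \<alpha> i \<and> t i \<in> immobile A) \<and>
      U + ?W = (\<Sum>i\<in>I. \<alpha> i *\<^sub>R sq_outer (t i)) + ?W"
    using I unfolding immobile_eq_zeros by blast
  ultimately show "cond_A2 A \<tau> S Js"
    unfolding cond_A2_def by blast
qed

subsection \<open>The conditions B1, B2 and I, and duality\<close>

lemma cond_B1_iff:
  "cond_B1 A J \<tau> S Js \<longleftrightarrow>
    (\<forall>z. (\<forall>t\<in>simplex_zeros Y. t \<bullet> (lin_map A z *v t) = 0) \<longrightarrow>
      (\<forall>j\<in>J. \<forall>k\<in>M_set A \<tau> j. z \<bullet> b_vec A \<tau> k j = 0))"
  unfolding cond_B1_def V0_forms_zero_iff[OF lin_map_in_sym_mats] inner_b_vec inner_axis_form ..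

lemma cond_B2_iff: "cond_B2 A Y \<longleftrightarrow> cond_B1 A J \<tau> S Js"
proof -
  have "lin_map A z \<in> tan_COP Y \<longleftrightarrow> (\<forall>t\<in>simplex_zeros Y. t \<bullet> (lin_map A z *v t) = 0)" for z
    by (simp add: tan_COP_eq[OF max_slack_COP] lin_map_in_sym_mats)
  moreover have "lin_map A z \<in> ldir_COP Y \<longleftrightarrow> (\<forall>j\<in>J. \<forall>k\<in>M_set A \<tau> j. z \<bullet> b_vec A \<tau> k j = 0)" for z
    by (simp add: ldir_COP_eq[OF max_slack_COP vertices_immobile zeros_subset_hull]
        lin_map_in_sym_mats inner_b_vec M_set_iff)
      (meson M_set_iff)
  moreover have "cond_B2 A Y \<longleftrightarrow> (\<forall>z. lin_map A z \<in> tan_COP Y \<longrightarrow> lin_map A z \<in> ldir_COP Y)"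
    by (auto simp: cond_B2_def)
  ultimately show ?thesis
    by (simp add: cond_B1_iff)
qed

text \<open>
  A feasible direction in the range of \<open>lin_map A\<close> leads, after rescaling, to another slack of the
  system, and on slacks the immobile indices have value zero.
\<close>

lemma lin_map_dir_imp_zero_on_immobile:
  assumes dir: "lin_map A z \<in> dir_COP Y" and t: "t \<in> simplex_zeros Y"
  shows "t \<bullet> (lin_map A z *v t) = 0"
proof -
  obtain e where e: "0 < e" "Y + e *\<^sub>R lin_map A z \<in> COP"
    using dir by (auto simp: dir_COP_def)
  obtain x where x: "Y = pencil A x"
    by (rule max_slack_feasible)
  \<comment> \<open>adding \<open>s *\<^sub>R Y\<close> keeps the matrix copositive and makes the coefficient of \<open>A None\<close> positive\<close>
  define s where "s = e * \<bar>z $ None\<bar>"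
  define x' :: "real ^ 'n option" where "x' = (\<chi> m. case m of None \<Rightarrow> 1 | Some m \<Rightarrow> x $ m)"
  define w where "w = (1 + s) *\<^sub>R x' + e *\<^sub>R z"
  have "0 \<le> s" using e(1) by (simp add: s_def)
  have "- (e * z $ None) \<le> s"
    using e(1) unfolding s_def by (metis abs_ge_minus_self abs_mult abs_of_pos)
  then have w_pos: "0 < w $ None"
    by (simp add: w_def x'_def)
  have w_eq: "lin_map A w = s *\<^sub>R Y + (Y + e *\<^sub>R lin_map A z)"
    unfolding w_def x x'_def linear_add[OF linear_lin_map] linear_scale[OF linear_lin_map]
      pencil_eq_lin_map[symmetric] by (simp add: scaleR_left_distrib)
  have "lin_map A w \<in> COP"
    unfolding w_eq using \<open>0 \<le> s\<close> max_slack_COP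
    by (intro convex_cone_add[OF convex_cone_COP _ e(2)] convex_cone_scaleR[OF convex_cone_COP])
  then have "(1 / w $ None) *\<^sub>R lin_map A w \<in> COP"
    using w_pos by (intro convex_cone_scaleR[OF convex_cone_COP]) auto
  then have "(\<chi> m. w $ Some m / w $ None) \<in> feasible A"
    using pencil_dehomogenize[OF w_pos, of A] by (simp add: feasible_def)
  then have "t \<bullet> (((1 / w $ None) *\<^sub>R lin_map A w) *v t) = 0"
    using t pencil_dehomogenize[OF w_pos, of A]
    unfolding immobile_eq_zeros[symmetric] immobile_def by force
  then have "t \<bullet> (lin_map A w *v t) = 0"
    using w_pos by (simp add: form_simps)
  then show ?thesis
    using simplex_zerosD(3)[OF t] e(1) by (simp add: w_eq form_simps)
qed

text \<open>
  Here condition I pays off: it transfers nonnegativity from the vectors \<open>a_vec A t\<close> to the vectors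
  \<open>b_vec A \<tau> k j\<close>, that is, to the gradients, where it implies that \<open>lin_map A z\<close> is a feasible direction.
\<close>

lemma forms_balanced_if_cond_I:
  assumes I: "cond_I A J \<tau>"
  shows forms_balanced
  unfolding forms_balanced_def
proof (intro allI impI ballI)
  fix z t assume nonneg: "\<forall>t\<in>simplex_zeros Y. 0 \<le> t \<bullet> (lin_map A z *v t)"
    and t: "t \<in> simplex_zeros Y"
  have "0 \<le> (lin_map A z *v v) $ k" if v: "v \<in> \<tau> ` J" and k: "(Y *v v) $ k = 0" for v k
  proof -
    obtain j where j: "j \<in> J" "v = \<tau> j" using v by blast
    with k have "k \<in> M_set A \<tau> j" by (simp add: M_set_iff)
    with I j have "b_vec A \<tau> k j \<in> lin_cone (a_vec A ` immobile A)"
      by (simp add: cond_I_def)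
    with nonneg have "0 \<le> z \<bullet> b_vec A \<tau> k j"
      by (rule nonneg_on_immobile_cone)
    then show ?thesis by (simp add: inner_b_vec j(2))
  qed
  then have "lin_map A z \<in> dir_COP Y"
    by (rule dir_COP_if_gradient_nonneg[OF max_slack_COP lin_map_in_sym_mats vertices_immobile
          zeros_subset_hull])
  then show "t \<bullet> (lin_map A z *v t) = 0"
    using t by (rule lin_map_dir_imp_zero_on_immobile)
qed

text \<open>
  From right to left: under A1 the cone is its own double orthogonal complement, and B1 says that every
  vector orthogonal to the cone is orthogonal to \<open>b_vec A \<tau> k j\<close>.
\<close>

lemma cond_I_iff: "cond_I A J \<tau> \<longleftrightarrow> cond_A1 A \<and> cond_B1 A J \<tau> S Js"
proof
  assume I: "cond_I A J \<tau>"
  then have "cond_B1 A J \<tau> S Js"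
    unfolding cond_B1_iff cond_I_def using zero_on_immobile_cone by blast
  with forms_balanced_if_cond_I[OF I] show "cond_A1 A \<and> cond_B1 A J \<tau> S Js"
    by (simp add: cond_A1_iff)
next
  let ?C = "lin_cone (a_vec A ` immobile A)"
  assume AB: "cond_A1 A \<and> cond_B1 A J \<tau> S Js"
  then have sub: "subspace ?C" by (simp add: cond_A1_def)
  show "cond_I A J \<tau>"
    unfolding cond_I_def
  proof (intro ballI)
    fix j k assume jk: "j \<in> J" "k \<in> M_set A \<tau> j"
    obtain y z where y: "y \<in> span ?C" and z: "\<And>w. w \<in> span ?C \<Longrightarrow> orthogonal z w"
      and b: "b_vec A \<tau> k j = y + z"
      using orthogonal_subspace_decomp_exists by blast
    have "z \<bullet> a_vec A t = 0" if "t \<in> simplex_zeros Y" for t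
    proof -
      have "a_vec A t \<in> ?C"
        unfolding lin_cone_eq_convex_cone_hull using that
        by (intro hull_inc) (simp add: immobile_eq_zeros)
      then show ?thesis
        using z span_base by (metis orthogonal_def)
    qed
    then have "z \<bullet> b_vec A \<tau> k j = 0"
      using AB jk unfolding cond_B1_iff inner_a_vec by blast
    moreover have "z \<bullet> y = 0"
      using z[OF y] by (simp add: orthogonal_def)
    ultimately have "z = 0"
      by (simp add: b inner_add_right)
    moreover have "y \<in> ?C"
      using y span_eq_iff[THEN iffD2, OF sub] by (simp only:)
    ultimately show "b_vec A \<tau> k j \<in> ?C"
      by (simp add: b)
  qed
qed

text \<open>
  For \<open>k \<in> M_set A \<tau> j\<close> take the last \<open>n\<close> coordinates of \<open>b_vec A \<tau> k j\<close> as objective. It is constant on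
  the feasible set, so the duality provides a completely positive \<open>U\<close> attaining this constant, which
  says that \<open>adj_map A U\<close> is \<open>b_vec A \<tau> k j\<close> and that \<open>U\<close> is orthogonal to \<open>Y\<close>.
\<close>

lemma cond_I_if_uniform_LP_duality:
  assumes duality: "uniform_LP_duality A"
  shows "cond_I A J \<tau>"
  unfolding cond_I_def
proof (intro ballI)
  fix j k assume jk: "j \<in> J" "k \<in> M_set A \<tau> j"
  let ?b = "b_vec A \<tau> k j"
  define c :: "real ^ 'n" where "c = (\<chi> m. ?b $ Some m)"
  have obj: "c \<bullet> x = - ?b $ None" if "x \<in> feasible A" for x
  proof -
    have "(pencil A x *v \<tau> j) $ k = 0"
      using jk(2) that by (simp add: M_set_def inner_axis_form)
    then have "(\<chi> m. case m of None \<Rightarrow> 1 | Some m \<Rightarrow> x $ m) \<bullet> ?b = 0"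
      by (simp add: inner_b_vec pencil_eq_lin_map)
    then show ?thesis
      by (simp add: inner_vec_def UNIV_option_conv sum.reindex c_def mult.commute)
  qed
  obtain x where x: "x \<in> feasible A" "Y = pencil A x"
    by (rule max_slack_feasible)
  then have val: "val_P A c = ereal (- ?b $ None)"
    unfolding val_P_def using obj by (intro antisym INF_lower2[of x] INF_greatest) auto
  then obtain U where opt: "dual_optimal A c U" and "val_P A c = val_D A c"
    using duality unfolding uniform_LP_duality_def by fastforce
  moreover have "val_D A c = ereal (- (U \<bullet>\<bullet> A None))"
    using opt unfolding val_D_def dual_optimal_def
    by (intro antisym SUP_least SUP_upper2[of U]) auto
  ultimately have "A None \<bullet>\<bullet> U = ?b $ None"
    using val by (simp add: mdot_commute)
  moreover have U: "U \<in> CP" "A (Some m) \<bullet>\<bullet> U = ?b $ Some m" for m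
    using opt by (auto simp: dual_optimal_def dual_feasible_def c_def mdot_commute)
  ultimately have b: "?b = adj_map A U"
    by (simp add: vec_eq_iff adj_map_def split_option_all)
  have "Y \<bullet>\<bullet> U = (\<chi> m. case m of None \<Rightarrow> 1 | Some m \<Rightarrow> x $ m) \<bullet> ?b"
    unfolding b inner_adj_map x(2) pencil_eq_lin_map ..
  also have "\<dots> = ?b $ None + c \<bullet> x"
    by (simp add: inner_vec_def UNIV_option_conv sum.reindex c_def mult.commute)
  also have "\<dots> = 0"
    using obj[OF x(1)] by simp
  finally have "Y \<bullet>\<bullet> U = 0" .
  moreover have "U \<in> sym_mats"
  proof -
    have "CP \<subseteq> (sym_mats :: (real ^ 'p ^ 'p) set)"
      unfolding CP_def using subspace_sym_mats sq_outer_in_sym_mats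
      by (intro hull_minimal subspace_imp_convex) auto
    with U(1) show ?thesis by blast
  qed
  ultimately have "U \<in> zero_face"
    using U(1) by (simp add: zero_face_eq mat_perp_def)
  then show "?b \<in> lin_cone (a_vec A ` immobile A)"
    unfolding immobile_cone_eq b by blast
qed

end

theorem lemma3:
  fixes A :: "'n::finite option \<Rightarrow> real ^ 'p::finite ^ 'p"
    and J :: "'j set" and \<tau> :: "'j \<Rightarrow> real ^ 'p"
    and S :: "'s set" and Js :: "'s \<Rightarrow> 'j list"
    and Y :: "real ^ 'p ^ 'p"
  assumes "CARD('p) > 1"
    and "\<And>m. A m \<in> sym_mats"
    and "consistent A"
    and "max_slack A Y"
    and "vertex_enumeration A J \<tau>"
    and "immobile_decomposition A J \<tau> S Js"
  shows "\<forall>cond_A \<in> {cond_A1 A, cond_A2 A \<tau> S Js, cond_A3 A Y}.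
         \<forall>cond_B \<in> {cond_B1 A J \<tau> S Js, cond_B2 A Y}.
           (cond_I A J \<tau> \<longleftrightarrow> cond_A \<and> cond_B) \<and>
           (uniform_LP_duality A \<longrightarrow> cond_I A J \<tau>) \<and>
           (uniform_LP_duality A \<longrightarrow> cond_A \<and> cond_B)"
proof -
  interpret copositive_system A J \<tau> S Js Y
    using assms by unfold_locales
  show ?thesis
    using cond_I_iff cond_A1_iff cond_A2_iff cond_A3_iff cond_B2_iff cond_I_if_uniform_LP_duality
    by auto
qed

end
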